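(* Let $G$ be a discrete countable group and let $S$ be a $G$-space that is amenable in the sense of Zimmer. Then for every finitely supported, generating probability measure $\lambda$ on $G$ and every convex function $f:(0,\infty)\to\mathbb{R}$ with $f(1)=0$, we have $$I_{\lambda,f}(S)=I_{\lambda,f}(G).$$
   Context: A $G$-space is a Borel space $X$ with a measurable action of $G$ and a fixed $G$-invariant measure class (the class of a probability measure); $M(X)$ denotes the set of probability measures on $X$ in this measure class. The spaces are not assumed to be standard. $G$ itself is a $G$-space by left translation with the measure class of the counting measure. A probability measure $\lambda$ on $G$ is generating if its support generates $G$. For $\nu\in M(X)$ the Furstenberg $(\lambda,f)$-entropy is $$h_{\lambda,f}(X,\nu)=\sum_{g\in G}\lambda(g)\int_X f\Big(\frac{dg\nu}{d\nu}\Big)\,d\nu\in[0,\infty],$$ where $g\nu$ is the push-forward of $\nu$ by $g$ (one may add a multiple of $t-1$ to $f$ without changing this, so one may take $f\ge 0$ and the integral is well defined). The minimal entropy number is $I_{\lambda,f}(X)=\inf_{\nu\in M(X)}h_{\lambda,f}(X,\nu)$. Amenability: given a $G$-equivariant measurable map $\pi:Y\to X$ of $G$-spaces carrying the measure class of $Y$ to that of $X$, a $G$-equivariant conditional expectation is a linear map $E:L^\infty(Y)\to L^\infty(X)$ with $E(f\circ g)=E(f)\circ g$ for $g\in G$, $E(f)\ge0$ whenever $f\ge 0$, $E(1)=1$, and $E((h\circ\pi)\cdot f)=h\cdot E(f)$ for $h\in L^\infty(X)$, $f\in L^\infty(Y)$. The $G$-space $S$ is amenable (in Zimmer's sense) if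 there is a $G$-equivariant conditional expectation $L^\infty(G\times S)\to L^\infty(S)$ for the projection $G\times S\to S$, where $G\times S$ has the product measure class and the diagonal action. *)

theory Defs
  imports "HOL-Algebra.Group_Action" "HOL-Algebra.Generated_Groups" "HOL-Probability.Probability"
begin

text \<open>A measure class is represented by a sigma-finite measure \<open>M\<close>, of which only the
  sigma-algebra and the null sets matter; \<open>class_probs M\<close> is the set of probability measures
  in the class.\<close>

definition class_probs :: "'a measure \<Rightarrow> 'a measure set" where
  "class_probs M = {\<nu>. prob_space \<nu> \<and> sets \<nu> = sets M \<and> null_sets \<nu> = null_sets M}"

text \<open>The group is discrete and (in all uses) countable, so measurability of the action means that
  each group element acts measurably. For a sigma-finite \<open>M\<close>, the condition
  \<open>class_probs M \<noteq> {}\<close> only excludes the zero measure.\<close>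

locale g_space = group_action G "space M" act + sigma_finite_measure M
  for G (structure) and M :: "'a measure" and act +
  assumes measurable_act: "g \<in> carrier G \<Longrightarrow> act g \<in> measurable M M"
    and invariant_class: "g \<in> carrier G \<Longrightarrow> null_sets (distr M M (act g)) = null_sets M"
    and class_probs_nonempty: "class_probs M \<noteq> {}"

text \<open>Actions in the sense of \<open>group_action\<close> are by extensional functions, hence the restrictions.\<close>

definition left_translation :: "('g, 'm) monoid_scheme \<Rightarrow> 'g \<Rightarrow> 'g \<Rightarrow> 'g" where
  "left_translation G g = (\<lambda>h\<in>carrier G. g \<otimes>\<^bsub>G\<^esub> h)"

definition diagonal_action ::
  "'a measure \<Rightarrow> ('g \<Rightarrow> 'a \<Rightarrow> 'a) \<Rightarrow> 'b measure \<Rightarrow> ('g \<Rightarrow> 'b \<Rightarrow> 'b) \<Rightarrow> 'g \<Rightarrow> 'a \<times> 'b \<Rightarrow> 'a \<times> 'b" where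
  "diagonal_action M actM N actN g = (\<lambda>(x, y)\<in>space M \<times> space N. (actM g x, actN g y))"

text \<open>Integral with values in the extended reals, meaningful when the negative part of \<open>u\<close> is
  integrable. For convex \<open>f\<close> on \<open>(0, \<infinity>)\<close> with \<open>f 1 = 0\<close> there is \<open>c\<close> with \<open>f t \<ge> c * (t - 1)\<close>, so this
  is the case in the entropy below, whose summands are nonnegative by Jensen's inequality.\<close>

definition ext_integral :: "'a measure \<Rightarrow> ('a \<Rightarrow> real) \<Rightarrow> ereal" where
  "ext_integral M u =
     enn2ereal (\<integral>\<^sup>+ x. ennreal (u x) \<partial>M) - enn2ereal (\<integral>\<^sup>+ x. ennreal (- u x) \<partial>M)"

text \<open>The derivative of \<open>g\<nu>\<close> with respect to \<open>\<nu>\<close> is almost everywhere in \<open>(0, \<infinity>)\<close>, since both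
  are finite measures in the same class; the values of \<open>f\<close> outside \<open>(0, \<infinity>)\<close> are irrelevant.\<close>

definition furstenberg_entropy ::
  "('g, 'm) monoid_scheme \<Rightarrow> ('g \<Rightarrow> 'a \<Rightarrow> 'a) \<Rightarrow> 'g pmf \<Rightarrow> (real \<Rightarrow> real) \<Rightarrow> 'a measure \<Rightarrow> ereal" where
  "furstenberg_entropy G act lam f \<nu> =
     (\<Sum>\<^sub>\<infinity>g\<in>carrier G. ereal (pmf lam g) *
        ext_integral \<nu> (\<lambda>x. f (enn2real (RN_deriv \<nu> (distr \<nu> \<nu> (act g)) x))))"

definition minimal_entropy ::
  "('g, 'm) monoid_scheme \<Rightarrow> 'a measure \<Rightarrow> ('g \<Rightarrow> 'a \<Rightarrow> 'a) \<Rightarrow> 'g pmf \<Rightarrow> (real \<Rightarrow> real) \<Rightarrow> ereal" where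
  "minimal_entropy G M act lam f = (INF \<nu>\<in>class_probs M. furstenberg_entropy G act lam f \<nu>)"

text \<open>Real \<open>L\<^sup>\<infinity>\<close>, on the level of representatives. A map between \<open>L\<^sup>\<infinity>\<close>-spaces is
  a map on representatives respecting equality almost everywhere, and identities in
  \<open>L\<^sup>\<infinity>\<close> hold almost everywhere.\<close>

definition L_infty :: "'a measure \<Rightarrow> ('a \<Rightarrow> real) set" where
  "L_infty M = {u \<in> borel_measurable M. \<exists>C. AE x in M. \<bar>u x\<bar> \<le> C}"

definition equivariant_cond_exp ::
  "('g, 'm) monoid_scheme \<Rightarrow> 'y measure \<Rightarrow> ('g \<Rightarrow> 'y \<Rightarrow> 'y) \<Rightarrow> 'x measure \<Rightarrow> ('g \<Rightarrow> 'x \<Rightarrow> 'x) \<Rightarrow>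
    ('y \<Rightarrow> 'x) \<Rightarrow> (('y \<Rightarrow> real) \<Rightarrow> 'x \<Rightarrow> real) \<Rightarrow> bool" where
  "equivariant_cond_exp G Y actY X actX \<pi> E \<longleftrightarrow>
     E \<in> L_infty Y \<rightarrow> L_infty X \<and>
     (\<forall>u\<in>L_infty Y. \<forall>v\<in>L_infty Y. (AE y in Y. u y = v y) \<longrightarrow> (AE x in X. E u x = E v x)) \<and>
     (\<forall>u\<in>L_infty Y. \<forall>v\<in>L_infty Y. \<forall>a b.
        AE x in X. E (\<lambda>y. a * u y + b * v y) x = a * E u x + b * E v x) \<and>
     (\<forall>g\<in>carrier G. \<forall>u\<in>L_infty Y. AE x in X. E (\<lambda>y. u (actY g y)) x = E u (actX g x)) \<and>
     (\<forall>u\<in>L_infty Y. (AE y in Y. 0 \<le> u y) \<longrightarrow> (AE x in X. 0 \<le> E u x)) \<and>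
     (AE x in X. E (\<lambda>y. 1) x = 1) \<and>
     (\<forall>h\<in>L_infty X. \<forall>u\<in>L_infty Y. AE x in X. E (\<lambda>y. h (\<pi> y) * u y) x = h x * E u x)"

definition zimmer_amenable ::
  "('g, 'm) monoid_scheme \<Rightarrow> 's measure \<Rightarrow> ('g \<Rightarrow> 's \<Rightarrow> 's) \<Rightarrow> bool" where
  "zimmer_amenable G S act \<longleftrightarrow>
     (\<exists>E. equivariant_cond_exp G
            (count_space (carrier G) \<Otimes>\<^sub>M S)
            (diagonal_action (count_space (carrier G)) (left_translation G) S act)
            S act snd E)"

end

theory Submission
  imports Defs
begin

text \<open>The idea is to describe the entropy by duality. After subtracting a multiple of \<open>t - 1\<close>, the convex
  function \<open>f\<close> is nonnegative, and the divergence of \<open>g\<nu>\<close> from \<open>\<nu>\<close> is the supremum of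
  \<open>\<integral>u d(g\<nu>) + \<integral>v d\<nu>\<close> over bounded functions with \<open>u * t + v \<le> f t\<close> for all \<open>t > 0\<close>
  (\<open>f_divergence_ge\<close>, \<open>f_divergence_le\<close>). A family of such functions \<open>u\<^sub>g\<close>, \<open>v\<^sub>g\<close>, one pair
  for each \<open>g\<close> in the support of \<open>\<lambda>\<close>, is called a field of lines below \<open>f\<close>.

  For any \<open>G\<close>-space \<open>S\<close>, the entropy on \<open>S\<close> has infimum at most that on \<open>G\<close>: a measure \<open>\<mu>\<close> on \<open>G\<close> and
  a measure \<open>\<nu>\<close> on \<open>S\<close> have a convolution on \<open>S\<close>, whose entropy is at most that of \<open>\<mu>\<close>
  (\<open>convolution_entropy_le\<close>).

  For the converse, let \<open>I\<close> be the infimum on \<open>G\<close>. A minimax argument on a compact product of sets of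
  lines gives, up to an arbitrarily small error, a field of lines below \<open>f\<close> on \<open>G\<close> with
  \<open>\<Sum>\<^sub>g \<lambda>(g) (u\<^sub>g(gh) + v\<^sub>g(h)) \<ge> I\<close> for every \<open>h\<close> (\<open>exists_dual_optimum\<close>). The error comes from
  mixing with a measure \<open>\<kappa>\<close> of full support whose translates have bounded derivatives, the law of a
  random walk at a geometric time (\<open>exists_bounded_ratio\<close>). Amenability provides a
  linear, positive, unital and equivariant map from bounded functions on \<open>G\<close> to bounded functions on \<open>S\<close>.
  It carries the field to a field of lines below \<open>f\<close> on \<open>S\<close>, which bounds the entropy of
  every measure on \<open>S\<close> from below by \<open>I\<close> up to the error (\<open>entropy_sum_ge\<close>). In this way no
  approximation of the conditional expectation by measurable families of measures is needed.\<close>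

section \<open>Divergences of equivalent probability measures\<close>

lemma convex_on_Ioi_subgradient:
  fixes f :: "real \<Rightarrow> real"
  assumes "convex_on {0<..} f"
  obtains a where "\<And>s t. 0 < s \<Longrightarrow> 0 < t \<Longrightarrow> f t + a t * (s - t) \<le> f s"
proof
  fix s t :: real assume "0 < s" "0 < t"
  then show "f t + (\<lambda>t. Inf ((\<lambda>s. (f t - f s) / (t - s)) ` ({t<..} \<inter> {0<..}))) t * (s - t) \<le> f s"
    using convex_le_Inf_differential[OF assms, of t s] by (simp add: interior_open)
qed

text \<open>The compact intervals $[1/(n+1),\, n+1]$, which exhaust $(0,\infty)$. On each of them the
  slopes and the intercepts of the tangents of a convex function are bounded.\<close>

definition window :: "nat \<Rightarrow> real set" where
  "window n = {inverse (real (Suc n))..real (Suc n)}"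

lemma window_pos:
  assumes "t \<in> window n"
  shows "0 < t"
proof -
  have "0 < inverse (real (Suc n))" by simp
  also have "\<dots> \<le> t" using assms by (simp add: window_def)
  finally show ?thesis .
qed

lemma window_mono: "m \<le> n \<Longrightarrow> window m \<subseteq> window n"
  by (auto simp: window_def intro: order_trans[OF le_imp_inverse_le])

lemma window_exhausts:
  assumes "0 < t"
  obtains n where "t \<in> window n"
proof -
  obtain n1 where n1: "inverse (real (Suc n1)) < t" using reals_Archimedean[OF assms] by auto
  obtain n2 where n2: "t \<le> real n2" using real_arch_simple by auto
  have "inverse (real (Suc (max n1 n2))) \<le> inverse (real (Suc n1))"
    by (intro le_imp_inverse_le) auto
  also note n1
  finally have "inverse (real (Suc (max n1 n2))) \<le> t" by (rule less_imp_le)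
  moreover have "t \<le> real (Suc (max n1 n2))" using n2 by simp
  ultimately have "t \<in> window (max n1 n2)" unfolding window_def by simp
  then show thesis by (rule that)
qed

text \<open>A nonnegative convex function \<open>f\<close> on $(0,\infty)$ that vanishes at \<open>1\<close>, together with a choice
  \<open>a t\<close> of the slope of a supporting line at every \<open>t > 0\<close>. Convexity is expressed by the
  supporting lines. The values of \<open>f\<close> and \<open>a\<close> outside $(0,\infty)$ are arbitrary.\<close>

locale entropy_generator =
  fixes f a :: "real \<Rightarrow> real"
  assumes tangent: "\<And>s t. 0 < s \<Longrightarrow> 0 < t \<Longrightarrow> f t + a t * (s - t) \<le> f s"
    and nonneg: "\<And>t. 0 < t \<Longrightarrow> 0 \<le> f t"
    and f_one: "f 1 = 0"
    and cont: "continuous_on {0<..} f"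
begin

lemma slope_mono:
  assumes "0 < s" "s \<le> t"
  shows "a s \<le> a t"
proof (cases "s = t")
  case False
  then have "0 < t - s" using assms by simp
  have "0 \<le> (a t - a s) * (t - s)"
    using tangent[of s t] tangent[of t s] assms by (simp add: algebra_simps)
  with \<open>0 < t - s\<close> show ?thesis by (simp add: zero_le_mult_iff)
qed simp

text \<open>The function \<open>f\<close> need not be measurable on the negative axis, and \<open>f 0\<close> is arbitrary; a
  nonnegative argument is all that matters for Radon-Nikodym derivatives.\<close>

lemma measurable_generator:
  assumes [measurable]: "r \<in> borel_measurable M" and "\<And>x. 0 \<le> r x"
  shows "(\<lambda>x. f (r x)) \<in> borel_measurable M"
proof -
  have [measurable]: "(\<lambda>t. if t \<in> {0<..} then f t else f 0) \<in> borel_measurable borel"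
    by (rule borel_measurable_continuous_on_if) (auto intro: cont)
  have "(\<lambda>x. (\<lambda>t. if t \<in> {0<..} then f t else f 0) (r x)) \<in> borel_measurable M"
    by measurable
  moreover have "(\<lambda>t. if t \<in> {0<..} then f t else f 0) (r x) = f (r x)" for x
    using assms(2)[of x] by (auto simp: order.order_iff_strict)
  ultimately show ?thesis by simp
qed

text \<open>Slope and intercept of the supporting line at \<open>t\<close>, replaced by the zero line when \<open>t\<close> is outside
  \<open>window n\<close>. As \<open>f \<ge> 0\<close>, the zero line lies below \<open>f\<close> as well, so this is always a minorant of \<open>f\<close>,
  with coefficients bounded in terms of \<open>n\<close> and depending on \<open>t\<close> in a Borel measurable way.\<close>

definition slope :: "nat \<Rightarrow> real \<Rightarrow> real" where
  "slope n t = (if t \<in> window n then a t else 0)"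

definition intercept :: "nat \<Rightarrow> real \<Rightarrow> real" where
  "intercept n t = (if t \<in> window n then f t - t * a t else 0)"

lemma window_tangent: 
  assumes "0 < s"
  shows "slope n t * s + intercept n t \<le> f s"
proof (cases "t \<in> window n")
  case True
  then have "0 < t" by (rule window_pos)
  then show ?thesis
    using tangent[OF assms, of t] True by (simp add: slope_def intercept_def algebra_simps)
qed (use nonneg[OF assms] in \<open>simp add: slope_def intercept_def\<close>)

lemma window_tangent_touch:
  "t \<in> window n \<Longrightarrow> slope n t * t + intercept n t = f t"
  by (simp add: slope_def intercept_def)

text \<open>Uniform bounds: \<open>slope_bound n\<close> for the slopes and \<open>window_bound n\<close> for slopes and intercepts.\<close>

definition slope_bound :: "nat \<Rightarrow> real" where
  "slope_bound n = \<bar>a (inverse (real (Suc n)))\<bar> + \<bar>a (real (Suc n))\<bar>"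

definition window_bound :: "nat \<Rightarrow> real" where
  "window_bound n = slope_bound n * (2 * real (Suc n) + 1)"

lemma abs_slope_le: "\<bar>slope n t\<bar> \<le> slope_bound n"
proof (cases "t \<in> window n")
  case True
  then have "0 < t" by (rule window_pos)
  with True have "a (inverse (real (Suc n))) \<le> a t" "a t \<le> a (real (Suc n))"
    using slope_mono[of "inverse (real (Suc n))" t] slope_mono[of t "real (Suc n)"]
    by (auto simp: window_def)
  then show ?thesis using True unfolding slope_def slope_bound_def by auto
qed (simp add: slope_def slope_bound_def)

lemma slope_bound_nonneg: "0 \<le> slope_bound n"
  by (simp add: slope_bound_def)

lemma generator_le_on_window:
  assumes "t \<in> window n"
  shows "f t \<le> slope_bound n * (real (Suc n) + 1)"
proof -
  have "0 < t" using assms by (rule window_pos)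
  then have "f t \<le> slope n t * (t - 1)"
    using tangent[of 1 t] assms by (simp add: f_one slope_def algebra_simps)
  also have "\<dots> \<le> \<bar>slope n t\<bar> * \<bar>t - 1\<bar>"
    by (metis abs_ge_self abs_mult)
  also have "\<dots> \<le> slope_bound n * (real (Suc n) + 1)"
    using assms \<open>0 < t\<close> by (intro mult_mono abs_slope_le slope_bound_nonneg) (auto simp: window_def)
  finally show ?thesis .
qed

lemma abs_slope_le_window_bound: "\<bar>slope n t\<bar> \<le> window_bound n"
proof -
  have "slope_bound n * 1 \<le> slope_bound n * (2 * real (Suc n) + 1)"
    by (intro mult_left_mono slope_bound_nonneg) simp
  then show ?thesis using abs_slope_le[of n t] by (simp add: window_bound_def)
qed

lemma abs_intercept_le: "\<bar>intercept n t\<bar> \<le> window_bound n"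
proof (cases "t \<in> window n")
  case True
  then have "0 < t" by (rule window_pos)
  have "\<bar>t * slope n t\<bar> \<le> real (Suc n) * slope_bound n"
    unfolding abs_mult using True \<open>0 < t\<close> by (intro mult_mono abs_slope_le) (auto simp: window_def)
  moreover have "intercept n t = f t - t * slope n t"
    using True by (simp add: intercept_def slope_def)
  moreover have "window_bound n = slope_bound n * (real (Suc n) + 1) + real (Suc n) * slope_bound n"
    by (simp add: window_bound_def algebra_simps)
  ultimately show ?thesis
    using generator_le_on_window[OF True] nonneg[OF \<open>0 < t\<close>] by linarith
qed (simp add: intercept_def window_bound_def slope_bound_nonneg)

lemma window_borel [measurable]: "window n \<in> sets borel"
  by (simp add: window_def)

lemma measurable_slope [measurable]: "slope n \<in> borel_measurable borel"
proof -
  have "mono_on (window n) a"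
    by (intro mono_onI slope_mono) (auto dest: window_pos)
  from borel_measurable_mono_on_fnc[OF this]
  show ?thesis unfolding slope_def
    by (subst measurable_If_restrict_space_iff) auto
qed

lemma measurable_intercept [measurable]: "intercept n \<in> borel_measurable borel"
proof -
  have [measurable]: "(\<lambda>t. if t \<in> window n then f t else 0) \<in> borel_measurable borel"
    by (intro borel_measurable_continuous_on_if continuous_on_subset[OF cont]) (auto dest: window_pos)
  have "intercept n = (\<lambda>t. (if t \<in> window n then f t else 0) - t * slope n t)"
    by (auto simp: fun_eq_iff intercept_def slope_def)
  then show ?thesis by simp
qed

end

text \<open>The \<open>f\<close>-divergence of \<open>P\<close> relative to \<open>Q\<close>, for \<open>P\<close> and \<open>Q\<close> in the same measure class and \<open>f \<ge> 0\<close>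
  on $(0,\infty)$.\<close>

definition f_divergence :: "(real \<Rightarrow> real) \<Rightarrow> 'a measure \<Rightarrow> 'a measure \<Rightarrow> ennreal" where
  "f_divergence f P Q = (\<integral>\<^sup>+ x. ennreal (f (enn2real (RN_deriv Q P x))) \<partial>Q)"

locale equivalent_probs = P: prob_space P + Q: prob_space Q for P Q :: "'a measure" +
  assumes sets_eq: "sets P = sets Q" and null_sets_eq: "null_sets P = null_sets Q"
begin

text \<open>The derivative of \<open>P\<close> with respect to \<open>Q\<close>, as a real function; it is almost everywhere positive, and
  the value \<open>0\<close> that replaces \<open>\<infinity>\<close> occurs on a null set only.\<close>

abbreviation r :: "'a \<Rightarrow> real" where "r x \<equiv> enn2real (RN_deriv Q P x)"

lemma abs_cont: "absolutely_continuous Q P"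
  by (simp add: absolutely_continuous_def null_sets_eq)

lemma measurable_eq: "borel_measurable P = borel_measurable Q"
  by (rule measurable_cong_sets[OF sets_eq refl])

lemma AE_iff: "(AE x in P. \<phi> x) \<longleftrightarrow> (AE x in Q. \<phi> x)"
  by (simp add: eventually_ae_filter null_sets_eq sets_eq_imp_space_eq[OF sets_eq])

lemma density_r: "density Q (\<lambda>x. ennreal (r x)) = P"
proof -
  have "AE x in Q. RN_deriv Q P x = ennreal (r x)"
    using Q.RN_deriv_finite[OF P.sigma_finite_measure_axioms abs_cont sets_eq]
    by eventually_elim (auto simp: less_top)
  then have "density Q (\<lambda>x. ennreal (r x)) = density Q (RN_deriv Q P)"
    by (intro density_cong) auto
  also have "\<dots> = P" by (rule Q.density_RN_deriv[OF abs_cont sets_eq])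
  finally show ?thesis .
qed

lemma r_pos: "AE x in Q. 0 < r x"
proof -
  have "AE x in P. 0 < r x"
  proof (subst density_r[symmetric], subst AE_density)
    show "AE x in Q. 0 < ennreal (r x) \<longrightarrow> 0 < r x" by simp
  qed simp
  then show ?thesis by (simp add: AE_iff)
qed

lemma integral_P:
  assumes "A \<in> borel_measurable Q"
  shows "(\<integral>x. A x \<partial>P) = (\<integral>x. r x * A x \<partial>Q)"
  using Q.RN_deriv_integral[OF P.sigma_finite_measure_axioms abs_cont sets_eq assms] .

lemma integrable_P:
  assumes "A \<in> borel_measurable Q"
  shows "integrable P A \<longleftrightarrow> integrable Q (\<lambda>x. r x * A x)"
  using Q.RN_deriv_integrable[OF P.sigma_finite_measure_axioms abs_cont sets_eq assms] .

lemma integrable_r: "integrable Q r"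
  using integrable_P[of "\<lambda>_. 1"] by simp

lemma integral_r: "(\<integral>x. r x \<partial>Q) = 1"
  using integral_P[of "\<lambda>_. 1"] P.prob_space by simp

lemma L_infty_integrable:
  assumes "A \<in> L_infty Q"
  shows "integrable Q A" "integrable P A"
proof -
  from assms obtain C where [measurable]: "A \<in> borel_measurable Q" and C: "AE x in Q. \<bar>A x\<bar> \<le> C"
    by (auto simp: L_infty_def)
  show "integrable Q A" by (rule Q.integrable_const_bound[where B = C]) (use C in auto)
  show "integrable P A" by (rule P.integrable_const_bound[where B = C])
    (use C in \<open>auto simp: AE_iff measurable_eq\<close>)
qed

lemma integral_tangent:
  assumes A: "A \<in> L_infty Q" and B: "B \<in> L_infty Q"
  shows "integrable Q (\<lambda>x. A x * r x + B x)"
    and "(\<integral>x. A x \<partial>P) + (\<integral>x. B x \<partial>Q) = (\<integral>x. A x * r x + B x \<partial>Q)"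
proof -
  have meas: "A \<in> borel_measurable Q" using A by (simp add: L_infty_def)
  have 1: "integrable Q (\<lambda>x. A x * r x)"
    using L_infty_integrable(2)[OF A] integrable_P[OF meas] by (simp add: mult.commute)
  note 2 = L_infty_integrable(1)[OF B]
  show "integrable Q (\<lambda>x. A x * r x + B x)" using 1 2 by simp
  show "(\<integral>x. A x \<partial>P) + (\<integral>x. B x \<partial>Q) = (\<integral>x. A x * r x + B x \<partial>Q)"
    using 1 2 integral_P[OF meas] by (simp add: mult.commute)
qed

text \<open>This lemma and the next one express the divergence as the supremum of
  \<open>\<integral>A dP + \<integral>B dQ\<close> over pairs of bounded functions with \<open>A x * t + B x \<le> f t\<close>. This dual form is
  linear in the pair of measures, which replaces all uses of Jensen's inequality.\<close>

lemma f_divergence_ge: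
  assumes A: "A \<in> L_infty Q" and B: "B \<in> L_infty Q"
    and le: "AE x in Q. A x * r x + B x \<le> f (r x)"
  shows "ennreal ((\<integral>x. A x \<partial>P) + (\<integral>x. B x \<partial>Q)) \<le> f_divergence f P Q"
proof -
  note int = integral_tangent[OF A B]
  have "(\<integral>x. A x \<partial>P) + (\<integral>x. B x \<partial>Q) \<le> (\<integral>x. max 0 (A x * r x + B x) \<partial>Q)"
    unfolding int(2) by (intro integral_mono integrable_max int) auto
  then have "ennreal ((\<integral>x. A x \<partial>P) + (\<integral>x. B x \<partial>Q)) \<le> ennreal (\<integral>x. max 0 (A x * r x + B x) \<partial>Q)"
    by (rule ennreal_leI)
  also have "\<dots> = (\<integral>\<^sup>+ x. ennreal (max 0 (A x * r x + B x)) \<partial>Q)"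
    by (intro nn_integral_eq_integral[symmetric] integrable_max int) auto
  also have "\<dots> \<le> f_divergence f P Q"
    unfolding f_divergence_def using le
    by (intro nn_integral_mono_AE, eventually_elim) (auto simp: max_def ennreal_leI ennreal_neg)
  finally show ?thesis .
qed

lemma f_divergence_le:
  assumes "entropy_generator f a"
    and le: "\<And>A B. A \<in> borel_measurable Q \<Longrightarrow> B \<in> borel_measurable Q \<Longrightarrow>
      (\<exists>C. \<forall>x. \<bar>A x\<bar> \<le> C \<and> \<bar>B x\<bar> \<le> C) \<Longrightarrow> (\<And>x t. 0 < t \<Longrightarrow> A x * t + B x \<le> f t) \<Longrightarrow>
      ennreal ((\<integral>x. A x \<partial>P) + (\<integral>x. B x \<partial>Q)) \<le> z"
  shows "f_divergence f P Q \<le> z"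
proof -
  interpret entropy_generator f a by fact
  \<comment> \<open>The pair \<open>(A n, B n)\<close> realises \<open>f (r x)\<close> where \<open>r x\<close> is in \<open>window n\<close>, and \<open>0\<close> elsewhere;
    these truncations increase to \<open>f (r x)\<close>.\<close>
  define A where "A n x = slope n (r x)" for n x
  define B where "B n x = intercept n (r x)" for n x
  have [measurable]: "A n \<in> borel_measurable Q" "B n \<in> borel_measurable Q" for n
    unfolding A_def B_def by measurable
  have bdd: "\<bar>A n x\<bar> \<le> window_bound n \<and> \<bar>B n x\<bar> \<le> window_bound n" for n x
    by (simp add: A_def B_def abs_slope_le_window_bound abs_intercept_le)
  then have L: "A n \<in> L_infty Q" "B n \<in> L_infty Q" for n
    by (auto simp: L_infty_def intro!: exI[of _ "window_bound n"])
  define F where "F n x = ennreal (A n x * r x + B n x)" for n x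
  have F_eq: "F n x = (if r x \<in> window n then ennreal (f (r x)) else 0)" for n x
    by (simp add: F_def A_def B_def slope_def intercept_def)
  have inc: "incseq (\<lambda>n. F n x)" for x
  proof (rule incseq_SucI)
    fix n
    show "F n x \<le> F (Suc n) x" unfolding F_eq using window_mono[of n "Suc n"] by auto
  qed
  have F_int: "(\<integral>\<^sup>+ x. F n x \<partial>Q) \<le> z" for n
  proof -
    have "AE x in Q. 0 \<le> A n x * r x + B n x"
    proof (rule AE_I2)
      fix x
      show "0 \<le> A n x * r x + B n x"
      proof (cases "r x \<in> window n")
        case True
        then have "0 < r x" by (rule window_pos)
        then show ?thesis using nonneg[of "r x"] window_tangent_touch[OF True] by (simp add: A_def B_def)
      next
        case False
        then show ?thesis by (simp add: A_def B_def slope_def intercept_def)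
      qed
    qed
    then have "(\<integral>\<^sup>+ x. F n x \<partial>Q) = ennreal (\<integral>x. A n x * r x + B n x \<partial>Q)"
      unfolding F_def by (intro nn_integral_eq_integral integral_tangent L)
    also have "\<dots> \<le> z"
      unfolding integral_tangent(2)[OF L, symmetric]
      by (rule le) (use bdd window_tangent in \<open>auto simp: A_def B_def\<close>)
    finally show ?thesis .
  qed
  have "f_divergence f P Q = (\<integral>\<^sup>+ x. (SUP n. F n x) \<partial>Q)"
    unfolding f_divergence_def
  proof (rule nn_integral_cong_AE, use r_pos in eventually_elim)
    fix x assume pos: "0 < r x"
    obtain n where "r x \<in> window n" using window_exhausts[OF pos] .
    then have "F n x = ennreal (f (r x))" by (simp add: F_eq)
    then have "ennreal (f (r x)) \<le> (SUP n. F n x)"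
      by (metis SUP_upper UNIV_I)
    then show "ennreal (f (r x)) = (SUP n. F n x)"
      by (intro antisym SUP_least) (auto simp: F_eq)
  qed
  also have "\<dots> = (SUP n. \<integral>\<^sup>+ x. F n x \<partial>Q)"
    by (rule nn_integral_monotone_convergence_SUP)
      (use inc in \<open>auto simp: incseq_def le_fun_def F_def\<close>)
  also have "\<dots> \<le> z" by (intro SUP_least F_int)
  finally show ?thesis .
qed

text \<open>Subtracting \<open>c * (t - 1)\<close> from \<open>f\<close> does not change the integral, because \<open>r\<close> has integral \<open>1\<close>.\<close>

lemma ext_integral_eq_f_divergence:
  assumes "entropy_generator (\<lambda>t. f t - c * (t - 1)) a"
  shows "ext_integral Q (\<lambda>x. f (r x)) = enn2ereal (f_divergence (\<lambda>t. f t - c * (t - 1)) P Q)"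
proof -
  interpret entropy_generator "\<lambda>t. f t - c * (t - 1)" a by fact
  define \<psi> where "\<psi> x = f (r x) - c * (r x - 1)" for x
  have [measurable]: "\<psi> \<in> borel_measurable Q"
    unfolding \<psi>_def by (rule measurable_generator) auto
  have f_r: "f (r x) = \<psi> x + c * (r x - 1)" for x by (simp add: \<psi>_def)
  have pos: "AE x in Q. 0 \<le> \<psi> x"
    using r_pos by eventually_elim (auto simp: \<psi>_def dest: nonneg)
  have int_c: "integrable Q (\<lambda>x. c * (r x - 1))" using integrable_r by simp
  have int_c_0: "(\<integral>x. c * (r x - 1) \<partial>Q) = 0"
    using integrable_r integral_r Q.prob_space by simp
  have D: "f_divergence (\<lambda>t. f t - c * (t - 1)) P Q = (\<integral>\<^sup>+ x. ennreal (\<psi> x) \<partial>Q)"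
    by (simp add: f_divergence_def \<psi>_def)
  have fin: "(\<integral>\<^sup>+ x. ennreal \<bar>c * (r x - 1)\<bar> \<partial>Q) < \<infinity>"
    using int_c unfolding integrable_iff_bounded real_norm_def ..
  have neg_fin: "(\<integral>\<^sup>+ x. ennreal (- f (r x)) \<partial>Q) < \<infinity>"
    by (rule le_less_trans[OF nn_integral_mono_AE fin], use pos in eventually_elim)
      (auto simp: f_r intro!: ennreal_leI)
  show ?thesis
  proof (cases "(\<integral>\<^sup>+ x. ennreal (\<psi> x) \<partial>Q) = \<infinity>")
    case True
    have "(\<integral>\<^sup>+ x. ennreal (\<psi> x) \<partial>Q) \<le> (\<integral>\<^sup>+ x. ennreal (f (r x)) + ennreal \<bar>c * (r x - 1)\<bar> \<partial>Q)"
    proof (rule nn_integral_mono)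
      fix x
      have "ennreal (\<psi> x) \<le> ennreal (max 0 (f (r x)) + \<bar>c * (r x - 1)\<bar>)"
        by (rule ennreal_leI) (simp add: f_r)
      also have "\<dots> = ennreal (f (r x)) + ennreal \<bar>c * (r x - 1)\<bar>"
        by (subst ennreal_plus) (auto simp: max_def ennreal_neg)
      finally show "ennreal (\<psi> x) \<le> ennreal (f (r x)) + ennreal \<bar>c * (r x - 1)\<bar>" .
    qed
    also have "\<dots> = (\<integral>\<^sup>+ x. ennreal (f (r x)) \<partial>Q) + (\<integral>\<^sup>+ x. ennreal \<bar>c * (r x - 1)\<bar> \<partial>Q)"
      unfolding f_r by (rule nn_integral_add) auto
    finally have "(\<integral>\<^sup>+ x. ennreal (f (r x)) \<partial>Q) = \<infinity>"
      using fin True by (auto simp: top_unique)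
    then show ?thesis unfolding ext_integral_def D True using neg_fin
      by (cases "\<integral>\<^sup>+ x. ennreal (- f (r x)) \<partial>Q") auto
  next
    case False
    then have int_\<psi>: "integrable Q \<psi>"
      by (intro integrableI_nonneg pos) (auto simp: less_top)
    then have int_f: "integrable Q (\<lambda>x. f (r x))" unfolding f_r using int_c by simp
    have fin2: "(\<integral>\<^sup>+ x. ennreal (f (r x)) \<partial>Q) < \<infinity>"
    proof (rule le_less_trans[OF nn_integral_mono])
      show "(\<integral>\<^sup>+ x. ennreal \<bar>f (r x)\<bar> \<partial>Q) < \<infinity>" using int_f by (simp add: integrable_iff_bounded)
    qed (auto intro: ennreal_leI)
    have "(\<integral>x. f (r x) \<partial>Q) = (\<integral>x. \<psi> x \<partial>Q)"
      unfolding f_r using int_\<psi> int_c int_c_0 by simp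
    moreover have "(\<integral>x. f (r x) \<partial>Q) =
        enn2real (\<integral>\<^sup>+ x. ennreal (f (r x)) \<partial>Q) - enn2real (\<integral>\<^sup>+ x. ennreal (- f (r x)) \<partial>Q)"
      by (rule real_lebesgue_integral_def[OF int_f])
    moreover have "(\<integral>\<^sup>+ x. ennreal (\<psi> x) \<partial>Q) = ennreal (\<integral>x. \<psi> x \<partial>Q)"
      by (rule nn_integral_eq_integral[OF int_\<psi> pos])
    moreover have "0 \<le> (\<integral>x. \<psi> x \<partial>Q)" by (rule integral_nonneg_AE[OF pos])
    ultimately show ?thesis unfolding ext_integral_def D using neg_fin fin2
      by (cases "\<integral>\<^sup>+ x. ennreal (f (r x)) \<partial>Q"; cases "\<integral>\<^sup>+ x. ennreal (- f (r x)) \<partial>Q") auto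
  qed
qed

end

section \<open>A minimax theorem and continuity of expectations\<close>

text \<open>If every convex combination of finitely many functions \<open>W k\<close> reaches the level \<open>c\<close> on the compact
  set \<open>D\<close>, then they reach it simultaneously. Instead of separating convex sets, one minimises the
  total squared deficit \<open>q\<close>: at a minimiser, the deficits themselves are weights whose combination
  of the \<open>W k\<close> stays below \<open>c\<close>, unless all of them vanish. The hypothesis \<open>convex\<close> says that
  between two points of \<open>D\<close> there is a point at which every \<open>W k\<close> takes the interpolated value;
  no linear structure on the ambient space is needed.\<close>

lemma minimax_finite:
  fixes W :: "'k \<Rightarrow> 'a::topological_space \<Rightarrow> real"
  assumes "compact D" "D \<noteq> {}" and "finite K"
    and cont: "\<And>k. k \<in> K \<Longrightarrow> continuous_on D (W k)"
    and convex: "\<And>x y \<tau>. x \<in> D \<Longrightarrow> y \<in> D \<Longrightarrow> 0 \<le> \<tau> \<Longrightarrow> \<tau> \<le> 1 \<Longrightarrow>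
      \<exists>z\<in>D. \<forall>k\<in>K. W k z = W k x + \<tau> * (W k y - W k x)"
    and mixed: "\<And>\<mu>. (\<And>k. k \<in> K \<Longrightarrow> 0 \<le> \<mu> k) \<Longrightarrow> sum \<mu> K = 1 \<Longrightarrow>
      \<exists>x\<in>D. c \<le> (\<Sum>k\<in>K. \<mu> k * W k x)"
  shows "\<exists>x\<in>D. \<forall>k\<in>K. c \<le> W k x"
proof -
  define q where "q x = (\<Sum>k\<in>K. (max 0 (c - W k x))\<^sup>2)" for x
  have "continuous_on D q"
    unfolding q_def by (intro continuous_intros cont)
  then obtain x0 where x0: "x0 \<in> D" and min: "\<And>y. y \<in> D \<Longrightarrow> q x0 \<le> q y"
    using continuous_attains_inf[OF assms(1,2)] by blast
  define p where "p k = max 0 (c - W k x0)" for k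
  have first_order: "(\<Sum>k\<in>K. p k * (W k x - W k x0)) \<le> 0" if x: "x \<in> D" for x
  proof -
    define d where "d k = W k x - W k x0" for k
    define Q where "Q = (\<Sum>k\<in>K. (d k)\<^sup>2)"
    have "0 \<le> Q" unfolding Q_def by (intro sum_nonneg) simp
    have *: "2 * (\<Sum>k\<in>K. p k * d k) \<le> \<tau> * Q" if \<tau>: "0 < \<tau>" "\<tau> \<le> 1" for \<tau>
    proof -
      obtain z where z: "z \<in> D" "\<And>k. k \<in> K \<Longrightarrow> W k z = W k x0 + \<tau> * d k"
        using convex[OF x0 x, of \<tau>] \<tau> unfolding d_def by auto
      have "(\<Sum>k\<in>K. (p k)\<^sup>2) = q x0" by (simp add: q_def p_def)
      also have "\<dots> \<le> q z" by (rule min[OF z(1)])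
      \<comment> \<open>Since \<open>c - W k z \<le> p k - \<tau> * d k\<close>, positive parts of the left side are dominated.\<close>
      also have "\<dots> \<le> (\<Sum>k\<in>K. (p k - \<tau> * d k)\<^sup>2)"
        unfolding q_def
      proof (rule sum_mono)
        fix k assume "k \<in> K"
        show "(max 0 (c - W k z))\<^sup>2 \<le> (p k - \<tau> * d k)\<^sup>2"
        proof (cases "c - W k z \<le> 0")
          case False
          then have "0 \<le> max 0 (c - W k z)" "max 0 (c - W k z) \<le> p k - \<tau> * d k"
            using z(2)[OF \<open>k \<in> K\<close>] by (auto simp: p_def)
          then show ?thesis by (simp add: power_mono)
        qed (simp add: max_def)
      qed
      also have "\<dots> = (\<Sum>k\<in>K. (p k)\<^sup>2) - 2 * \<tau> * (\<Sum>k\<in>K. p k * d k) + \<tau>\<^sup>2 * Q"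
      proof -
        have "(p k - \<tau> * d k)\<^sup>2 = (p k)\<^sup>2 - 2 * \<tau> * (p k * d k) + \<tau>\<^sup>2 * (d k)\<^sup>2" for k
          by (simp add: power2_eq_square algebra_simps)
        then show ?thesis by (simp only: Q_def sum.distrib sum_subtractf sum_distrib_left)
      qed
      finally have "\<tau> * (2 * (\<Sum>k\<in>K. p k * d k)) \<le> \<tau> * (\<tau> * Q)"
        by (simp add: power2_eq_square algebra_simps)
      then show ?thesis using \<tau> by (simp only: mult_le_cancel_left_pos)
    qed
    have "(\<Sum>k\<in>K. p k * d k) \<le> 0"
    proof (rule ccontr)
      assume "\<not> ?thesis"
      then have pos: "0 < (\<Sum>k\<in>K. p k * d k)" by simp
      define \<tau> where "\<tau> = min 1 ((\<Sum>k\<in>K. p k * d k) / (Q + 1))"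
      have "0 < \<tau>" "\<tau> \<le> 1" using pos \<open>0 \<le> Q\<close> by (auto simp: \<tau>_def)
      from *[OF this] have "2 * (\<Sum>k\<in>K. p k * d k) \<le> \<tau> * Q" .
      also have "\<dots> \<le> (\<Sum>k\<in>K. p k * d k) / (Q + 1) * Q"
        using \<open>0 \<le> Q\<close> by (intro mult_right_mono) (auto simp: \<tau>_def)
      also have "\<dots> \<le> (\<Sum>k\<in>K. p k * d k)"
        using \<open>0 \<le> Q\<close> pos by (simp add: field_simps)
      finally show False using pos by simp
    qed
    then show ?thesis by (simp add: d_def)
  qed
  show ?thesis
  proof (rule ccontr)
    assume contr: "\<not> ?thesis"
    define s where "s = sum p K"
    have p_nonneg: "0 \<le> p k" for k by (simp add: p_def)
    obtain k0 where "k0 \<in> K" "\<not> c \<le> W k0 x0" using contr x0 by blast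
    then have "0 < p k0" by (simp add: p_def)
    have "0 < s" unfolding s_def using \<open>finite K\<close> \<open>k0 \<in> K\<close> \<open>0 < p k0\<close> p_nonneg by (intro sum_pos2[of K k0]) auto
    have "\<exists>x\<in>D. c \<le> (\<Sum>k\<in>K. p k / s * W k x)"
      using \<open>0 < s\<close> p_nonneg by (intro mixed) (auto simp: s_def sum_divide_distrib[symmetric])
    then obtain x where x: "x \<in> D" "c \<le> (\<Sum>k\<in>K. p k / s * W k x)" by blast
    have "c * s \<le> (\<Sum>k\<in>K. p k * W k x)"
      using x(2) \<open>0 < s\<close> by (simp add: sum_divide_distrib[symmetric] pos_le_divide_eq)
    also have "\<dots> \<le> (\<Sum>k\<in>K. p k * W k x0)"
      using first_order[OF x(1)] by (simp add: algebra_simps sum_subtractf)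
    also have "\<dots> < (\<Sum>k\<in>K. p k * c)"
    proof (rule sum_strict_mono_ex1[OF \<open>finite K\<close>])
      show "\<forall>k\<in>K. p k * W k x0 \<le> p k * c"
        by (auto simp: p_def max_def intro: mult_left_mono)
      show "\<exists>k\<in>K. p k * W k x0 < p k * c"
        using \<open>k0 \<in> K\<close> \<open>0 < p k0\<close> \<open>\<not> c \<le> W k0 x0\<close>
        by (intro bexI[of _ k0] mult_strict_left_mono) auto
    qed
    also have "\<dots> = c * s" by (simp add: s_def sum_distrib_left mult.commute)
    finally show False by simp
  qed
qed

text \<open>The same for an arbitrary family, by the finite intersection property.\<close>

lemma minimax:
  fixes W :: "'k \<Rightarrow> 'a::topological_space \<Rightarrow> real"
  assumes "compact D" "closed D" "D \<noteq> {}"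
    and cont: "\<And>k. k \<in> Z \<Longrightarrow> continuous_on D (W k)"
    and convex: "\<And>x y \<tau>. x \<in> D \<Longrightarrow> y \<in> D \<Longrightarrow> 0 \<le> \<tau> \<Longrightarrow> \<tau> \<le> 1 \<Longrightarrow>
      \<exists>z\<in>D. \<forall>k\<in>Z. W k z = W k x + \<tau> * (W k y - W k x)"
    and mixed: "\<And>K \<mu>. finite K \<Longrightarrow> K \<subseteq> Z \<Longrightarrow> (\<And>k. k \<in> K \<Longrightarrow> 0 \<le> \<mu> k) \<Longrightarrow> sum \<mu> K = 1 \<Longrightarrow>
      \<exists>x\<in>D. c \<le> (\<Sum>k\<in>K. \<mu> k * W k x)"
  shows "\<exists>x\<in>D. \<forall>k\<in>Z. c \<le> W k x"
proof -
  have "D \<inter> (\<Inter>k\<in>Z. D \<inter> {x \<in> D. c \<le> W k x}) \<noteq> {}"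
  proof (rule compact_imp_fip_image[OF \<open>compact D\<close>])
    fix k assume "k \<in> Z"
    show "closed (D \<inter> {x \<in> D. c \<le> W k x})"
      using continuous_closed_preimage[OF cont[OF \<open>k \<in> Z\<close>] \<open>closed D\<close>, of "{c..}"] \<open>closed D\<close>
      by (simp add: vimage_def Collect_conj_eq Int_ac)
  next
    fix K assume K: "finite K" "K \<subseteq> Z"
    have "\<exists>x\<in>D. \<forall>k\<in>K. c \<le> W k x"
    proof (rule minimax_finite[OF assms(1,3) K(1)])
      show "continuous_on D (W k)" if "k \<in> K" for k using cont K that by blast
      show "\<exists>z\<in>D. \<forall>k\<in>K. W k z = W k x + \<tau> * (W k y - W k x)"
        if "x \<in> D" "y \<in> D" "0 \<le> \<tau>" "\<tau> \<le> 1" for x y \<tau>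
        using convex[OF that] K by blast
    qed (rule mixed[OF K])
    then show "D \<inter> (\<Inter>k\<in>K. D \<inter> {x \<in> D. c \<le> W k x}) \<noteq> {}" by blast
  qed
  then show ?thesis by blast
qed

text \<open>Tychonoff's theorem for the topology of pointwise convergence on functions.\<close>

lemma compact_Pi:
  fixes S :: "'a \<Rightarrow> 'b::topological_space set"
  assumes "\<And>i. compact (S i)"
  shows "compact {x. \<forall>i. x i \<in> S i}"
proof -
  have "compactin (product_topology (\<lambda>i. euclidean) UNIV) (PiE UNIV S)"
    unfolding compactin_PiE using assms by simp
  then show ?thesis
    by (simp add: euclidean_product_topology PiE_UNIV_domain Pi_def)
qed

lemma closed_Pi:
  fixes S :: "'a \<Rightarrow> 'b::topological_space set"
  assumes "\<And>i. closed (S i)"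
  shows "closed {x. \<forall>i. x i \<in> S i}"
proof -
  have "closed ((\<lambda>x. x i) -` S i)" for i
    by (rule closed_vimage[OF assms continuous_on_product_coordinates])
  then have "closed (\<Inter>i. (\<lambda>x. x i) -` S i)" by blast
  then show ?thesis by (simp add: vimage_def Collect_all_eq)
qed

lemma continuous_on_expectation:
  fixes w :: "'a::topological_space \<Rightarrow> 'g \<Rightarrow> real"
  assumes cont: "\<And>y. continuous_on D (\<lambda>x. w x y)"
    and bdd: "\<And>x y. x \<in> D \<Longrightarrow> \<bar>w x y\<bar> \<le> B"
  shows "continuous_on D (\<lambda>x. measure_pmf.expectation p (w x))"
proof -
  have abs: "Infinite_Set_Sum.abs_summable_on (\<lambda>y. pmf p y * w x y) UNIV" if "x \<in> D" for x
  proof (rule abs_summable_on_comparison_test)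
    show "Infinite_Set_Sum.abs_summable_on (\<lambda>y. pmf p y * B) UNIV"
      by (intro abs_summable_on_cmult_left pmf_abs_summable)
    show "norm (pmf p y * w x y) \<le> norm (pmf p y * B)" for y
      using bdd[OF that, of y] by (auto simp: abs_mult intro!: mult_left_mono)
  qed
  have summable: "(\<lambda>y. pmf p y * B) summable_on UNIV"
    by (rule summable_on_cmult_left, rule abs_summable_summable, subst abs_summable_equivalent,
        rule pmf_abs_summable)
  have eq: "measure_pmf.expectation p (w x) = (\<Sum>\<^sub>\<infinity>y. pmf p y * w x y)" if "x \<in> D" for x
    by (simp add: pmf_expectation_eq_infsetsum infsetsum_infsum[OF abs[OF that]])
  have "uniform_limit D (\<lambda>Y x. \<Sum>y\<in>Y. pmf p y * w x y) (\<lambda>x. \<Sum>\<^sub>\<infinity>y. pmf p y * w x y) (finite_subsets_at_top UNIV)"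
    by (rule Weierstrass_m_test_general[OF _ summable])
      (auto simp: abs_mult intro!: mult_mono bdd)
  then have "continuous_on D (\<lambda>x. \<Sum>\<^sub>\<infinity>y. pmf p y * w x y)"
    by (rule uniform_limit_theorem[rotated])
      (auto intro!: always_eventually continuous_intros cont)
  then show ?thesis by (simp add: eq cong: continuous_on_cong)
qed

section \<open>Measures on the group with bounded derivatives\<close>

lemma expectation_bind_pmf:
  fixes h :: "'b \<Rightarrow> real"
  assumes "\<And>x. \<bar>h x\<bar> \<le> B"
  shows "measure_pmf.expectation (bind_pmf p k) h =
    measure_pmf.expectation p (\<lambda>x. measure_pmf.expectation (k x) h)"
  unfolding measure_pmf_bind
  by (rule integral_bind[where K = "count_space UNIV" and B = B and B' = 1])
    (use assms in \<open>auto simp: measure_pmf.finite_measure_axioms measure_pmf_in_subprob_algebra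
      intro!: measure_pmf.subprob_emeasure_le_1\<close>)

context group
begin

text \<open>The law of the product of \<open>n\<close> independent uniformly distributed elements of \<open>T\<close>.\<close>

primrec walk :: "'a set \<Rightarrow> nat \<Rightarrow> 'a pmf" where
  "walk T 0 = return_pmf \<one>"
| "walk T (Suc n) = bind_pmf (pmf_of_set T) (\<lambda>g. map_pmf (\<lambda>x. g \<otimes> x) (walk T n))"

lemma walk_mult:
  assumes T: "finite T" "T \<noteq> {}" "T \<subseteq> carrier G"
    and y: "y \<in> set_pmf (walk T n)" "y \<in> carrier G"
  shows "x \<in> set_pmf (walk T m) \<Longrightarrow> x \<otimes> y \<in> set_pmf (walk T (m + n)) \<and> x \<in> carrier G"
proof (induction m arbitrary: x)
  case (Suc m)
  then obtain g z where g: "g \<in> T" and z: "z \<in> set_pmf (walk T m)" and x: "x = g \<otimes> z"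
    using T by (auto simp: set_pmf_of_set)
  have "z \<otimes> y \<in> set_pmf (walk T (m + n))" "z \<in> carrier G" using Suc.IH[OF z] by auto
  then show ?case using g x T y(2) by (force simp: set_pmf_of_set m_assoc)
qed (use y in auto)

lemma walk_closed:
  assumes T: "finite T" "T \<noteq> {}" "T \<subseteq> carrier G"
  shows "x \<in> set_pmf (walk T m) \<Longrightarrow> x \<in> carrier G"
  using walk_mult[OF T, of \<one> 0 x m] by auto

lemma walk_reaches:
  assumes T: "finite T" "T \<noteq> {}" "T \<subseteq> carrier G" and inv: "\<And>g. g \<in> T \<Longrightarrow> inv g \<in> T"
    and x: "x \<in> generate G T"
  shows "\<exists>n. x \<in> set_pmf (walk T n)"
proof -
  have step: "\<exists>n. g \<in> set_pmf (walk T n)" if "g \<in> T" for g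
    using that T by (intro exI[of _ "Suc 0"]) (force simp: set_pmf_of_set)
  show ?thesis using x
  proof (induction rule: generate.induct)
    case one
    show ?case by (intro exI[of _ 0]) simp
  next
    case (eng x y)
    then show ?case using walk_mult[OF T] walk_closed[OF T] by blast
  qed (use step inv in auto)
qed

text \<open>Probability measures of full support on \<open>G\<close> whose translates by the elements of \<open>T\<close> are
  dominated by a multiple of the measure itself. When \<open>T\<close> is closed under inverses, the derivatives of
  these translates are therefore bounded away from \<open>0\<close> and from infinity.\<close>

definition bounded_ratio :: "'a set \<Rightarrow> real \<Rightarrow> 'a pmf \<Rightarrow> bool" where
  "bounded_ratio T N p \<longleftrightarrow> set_pmf p = carrier G \<and>
    (\<forall>g\<in>T. \<forall>x\<in>carrier G. pmf p (g \<otimes> x) \<le> N * pmf p x)"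

lemma bounded_ratio_mono:
  assumes "bounded_ratio T N p" "N \<le> N'"
  shows "bounded_ratio T N' p"
  using assms unfolding bounded_ratio_def by (meson mult_right_mono order_trans pmf_nonneg)

lemma pmf_map_left_ge:
  assumes "g \<in> carrier G" "x \<in> carrier G"
  shows "pmf p x \<le> pmf (map_pmf (\<lambda>x. g \<otimes> x) p) (g \<otimes> x)"
  unfolding pmf_map by (subst pmf.rep_eq, rule measure_pmf.finite_measure_mono) auto

text \<open>The random walk on \<open>G\<close> stopped at an independent geometric time has full support. Conditioning
  the time on being positive inserts one more step \<open>g \<in> T\<close>, so the mass at \<open>g \<otimes> y\<close> is at least
  the mass at \<open>y\<close> divided by \<open>2 * card T\<close>.\<close>

lemma exists_bounded_ratio:
  assumes T: "finite T" "T \<noteq> {}" "T \<subseteq> carrier G" and inv: "\<And>g. g \<in> T \<Longrightarrow> inv g \<in> T"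
    and gen: "generate G T = carrier G"
  shows "\<exists>p N. bounded_ratio T N p"
proof (intro exI)
  define \<kappa> where "\<kappa> = bind_pmf (geometric_pmf (1/2)) (walk T)"
  define N where "N = 2 * real (card T)"
  have "card T > 0" using T by (simp add: card_gt_0_iff)
  have set_\<kappa>: "set_pmf \<kappa> = carrier G"
    using walk_reaches[OF T inv] walk_closed[OF T] gen by (auto simp: \<kappa>_def set_pmf_geometric)
  have walk_Suc: "pmf (walk T n) y / real (card T) \<le> pmf (walk T (Suc n)) (g \<otimes> y)"
    if "g \<in> T" "y \<in> carrier G" for g y n
  proof -
    have "pmf (walk T n) y \<le> pmf (map_pmf (\<lambda>x. g \<otimes> x) (walk T n)) (g \<otimes> y)"
      using that T by (intro pmf_map_left_ge) auto
    also have "\<dots> \<le> (\<Sum>h\<in>T. pmf (map_pmf (\<lambda>x. h \<otimes> x) (walk T n)) (g \<otimes> y))"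
      using that T by (intro member_le_sum) auto
    finally show ?thesis using T by (simp add: pmf_bind_pmf_of_set divide_right_mono)
  qed
  have step: "pmf \<kappa> y \<le> N * pmf \<kappa> (g \<otimes> y)" if "g \<in> T" "y \<in> carrier G" for g y
  proof -
    have "\<kappa> = bind_pmf (bernoulli_pmf (1/2)) (\<lambda>b. if b then walk T 0
        else bind_pmf (geometric_pmf (1/2)) (\<lambda>n. walk T (Suc n)))"
      unfolding \<kappa>_def
      by (subst geometric_bind_pmf_unfold)
        (auto simp: bind_assoc_pmf bind_map_pmf bind_return_pmf simp del: walk.simps intro!: bind_pmf_cong)
    then have "pmf \<kappa> (g \<otimes> y) = pmf (walk T 0) (g \<otimes> y) / 2
        + pmf (bind_pmf (geometric_pmf (1/2)) (\<lambda>n. walk T (Suc n))) (g \<otimes> y) / 2"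
      by (simp add: pmf_bind[of "bernoulli_pmf _"] del: walk.simps)
    also have "\<dots> \<ge> pmf (bind_pmf (geometric_pmf (1/2)) (\<lambda>n. walk T (Suc n))) (g \<otimes> y) / 2"
      by simp
    finally have "pmf (bind_pmf (geometric_pmf (1/2)) (\<lambda>n. walk T (Suc n))) (g \<otimes> y) \<le> 2 * pmf \<kappa> (g \<otimes> y)"
      by simp
    moreover have "pmf \<kappa> y / real (card T) \<le> pmf (bind_pmf (geometric_pmf (1/2)) (\<lambda>n. walk T (Suc n))) (g \<otimes> y)"
      unfolding \<kappa>_def pmf_bind integral_divide_zero[symmetric]
      by (intro integral_mono walk_Suc that measure_pmf.integrable_const_bound[where B = 1])
        (use \<open>card T > 0\<close> in \<open>auto simp: pmf_le_1 divide_le_eq simp del: walk.simps intro!: AE_I2 order_trans[OF pmf_le_1]\<close>)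
    ultimately have "pmf \<kappa> y / real (card T) \<le> 2 * pmf \<kappa> (g \<otimes> y)" by (rule order_trans[rotated])
    then show ?thesis using \<open>card T > 0\<close> by (simp add: N_def field_simps)
  qed
  have "pmf \<kappa> (g \<otimes> x) \<le> N * pmf \<kappa> x" if "g \<in> T" "x \<in> carrier G" for g x
  proof -
    have g: "g \<in> carrier G" using that T by auto
    then have "inv g \<otimes> (g \<otimes> x) = x" using that by (simp add: m_assoc[symmetric])
    then show ?thesis using step[OF inv[OF that(1)], of "g \<otimes> x"] g that by simp
  qed
  then show "bounded_ratio T N \<kappa>" by (simp add: bounded_ratio_def set_\<kappa>)
qed

text \<open>The mixture \<open>t * p + (1 - t) * \<delta>\<close>, where \<open>\<delta>\<close> is the point mass at the identity.\<close>

definition lazy :: "real \<Rightarrow> 'a pmf \<Rightarrow> 'a pmf" where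
  "lazy t p = bind_pmf (bernoulli_pmf t) (\<lambda>b. if b then p else return_pmf \<one>)"

lemma pmf_lazy: "0 \<le> t \<Longrightarrow> t \<le> 1 \<Longrightarrow> pmf (lazy t p) x = t * pmf p x + (1 - t) * indicator {\<one>} x"
  by (cases "x = \<one>") (auto simp: lazy_def pmf_bind)

lemma bounded_ratio_lazy:
  assumes p: "bounded_ratio T N p" and t: "0 < t" "t < 1"
    and T: "finite T" "T \<subseteq> carrier G"
  shows "\<exists>N'. bounded_ratio T N' (lazy t p)"
proof (intro exI)
  have set_p: "set_pmf p = carrier G" using p by (simp add: bounded_ratio_def)
  have set_l: "set_pmf (lazy t p) = carrier G"
    using t by (simp add: lazy_def set_pmf_bernoulli UNIV_bool set_p insert_absorb)
  \<comment> \<open>The sum handles the case \<open>g \<otimes> x = \<one>\<close>, where the point mass enters on the left side.\<close>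
  define N' where "N' = \<bar>N\<bar> + (\<Sum>g\<in>T. 1 / (t * pmf p (inv g)))"
  have pos: "0 < pmf p x" if "x \<in> carrier G" for x
    using that set_p by (simp add: pmf_positive_iff)
  have "pmf (lazy t p) (g \<otimes> x) \<le> N' * pmf (lazy t p) x" if g: "g \<in> T" and x: "x \<in> carrier G" for g x
  proof (cases "g \<otimes> x = \<one>")
    case True
    then have x_eq: "x = inv g" using g x T by (metis inv_equality inv_inv subsetD)
    have "1 = 1 / (t * pmf p (inv g)) * (t * pmf p x)"
      using t pos[OF x] by (simp add: x_eq)
    also have "\<dots> \<le> N' * (t * pmf p x)"
    proof (rule mult_right_mono)
      have "1 / (t * pmf p (inv g)) \<le> (\<Sum>g\<in>T. 1 / (t * pmf p (inv g)))"
        using g T t by (intro member_le_sum) auto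
      then show "1 / (t * pmf p (inv g)) \<le> N'" by (simp add: N'_def)
    qed (use t in auto)
    also have "\<dots> \<le> N' * pmf (lazy t p) x"
      using t by (intro mult_left_mono) (auto simp: pmf_lazy N'_def intro!: add_nonneg_nonneg sum_nonneg)
    finally show ?thesis using pmf_le_1[of "lazy t p" "g \<otimes> x"] by linarith
  next
    case False
    have "pmf (lazy t p) (g \<otimes> x) = t * pmf p (g \<otimes> x)" using False t by (simp add: pmf_lazy)
    also have "\<dots> \<le> t * (N * pmf p x)"
      using p g x t by (intro mult_left_mono) (auto simp: bounded_ratio_def)
    also have "\<dots> \<le> t * (N' * pmf p x)"
      using t by (intro mult_left_mono mult_right_mono)
        (auto simp: N'_def intro!: add_increasing2 sum_nonneg)
    also have "\<dots> = N' * (t * pmf p x)" by simp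
    also have "\<dots> \<le> N' * pmf (lazy t p) x"
      using t by (intro mult_left_mono) (auto simp: pmf_lazy N'_def intro!: add_nonneg_nonneg sum_nonneg)
    finally show ?thesis .
  qed
  then show "bounded_ratio T N' (lazy t p)" by (simp add: bounded_ratio_def set_l)
qed

lemma pmf_right_translate:
  assumes "set_pmf p = carrier G" "k \<in> carrier G" "x \<in> carrier G"
  shows "pmf (map_pmf (\<lambda>y. y \<otimes> k) p) x = pmf p (x \<otimes> inv k)"
proof -
  have "inj_on (\<lambda>y. y \<otimes> k) (set_pmf p)" using assms by (auto intro!: inj_onI)
  from pmf_map_inj[OF this, of "x \<otimes> inv k"] show ?thesis using assms by (simp add: m_assoc)
qed

text \<open>Right translations commute with the left translations by \<open>T\<close>, so the constant \<open>N\<close> is preserved.\<close>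

lemma bounded_ratio_translate:
  assumes p: "bounded_ratio T N p" and k: "k \<in> carrier G" and T: "T \<subseteq> carrier G"
  shows "bounded_ratio T N (map_pmf (\<lambda>y. y \<otimes> k) p)"
proof -
  have set_p: "set_pmf p = carrier G" using p by (simp add: bounded_ratio_def)
  have "x \<in> (\<lambda>y. y \<otimes> k) ` carrier G" if "x \<in> carrier G" for x
    using that k by (intro image_eqI[of _ _ "x \<otimes> inv k"]) (auto simp: m_assoc)
  then have "(\<lambda>y. y \<otimes> k) ` carrier G = carrier G" using k by auto
  moreover have "pmf (map_pmf (\<lambda>y. y \<otimes> k) p) (g \<otimes> x) \<le> N * pmf (map_pmf (\<lambda>y. y \<otimes> k) p) x"
    if "g \<in> T" "x \<in> carrier G" for g x
    using that k T p by (subst (1 2) pmf_right_translate) (auto simp: set_p m_assoc bounded_ratio_def)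
  ultimately show ?thesis by (simp add: bounded_ratio_def set_p)
qed

lemma bounded_ratio_bind:
  assumes "\<And>k. k \<in> set_pmf \<mu> \<Longrightarrow> bounded_ratio T N (p k)" 
  shows "bounded_ratio T N (bind_pmf \<mu> p)"
proof -
  have "set_pmf (bind_pmf \<mu> p) = carrier G"
    using assms set_pmf_not_empty[of \<mu>] by (auto simp: bounded_ratio_def)
  moreover have "pmf (bind_pmf \<mu> p) (g \<otimes> x) \<le> N * pmf (bind_pmf \<mu> p) x"
    if "g \<in> T" "x \<in> carrier G" for g x
    unfolding pmf_bind integral_mult_right_zero[symmetric]
    by (intro integral_mono_AE integrable_mult_right measure_pmf.integrable_const_bound[where B = 1])
      (use assms that in \<open>auto simp: pmf_le_1 AE_measure_pmf_iff bounded_ratio_def\<close>)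
  ultimately show ?thesis by (simp add: bounded_ratio_def)
qed

end

section \<open>Dual description of the entropy on the group\<close>

text \<open>The Furstenberg entropy for a function \<open>f\<close> that is nonnegative on $(0,\infty)$, with values in
  \<open>ennreal\<close>.\<close>

definition entropy_sum ::
  "('g \<Rightarrow> 'a \<Rightarrow> 'a) \<Rightarrow> 'g pmf \<Rightarrow> (real \<Rightarrow> real) \<Rightarrow> 'a measure \<Rightarrow> ennreal" where
  "entropy_sum act lam f \<nu> =
    (\<Sum>g\<in>set_pmf lam. ennreal (pmf lam g) * f_divergence f (distr \<nu> \<nu> (act g)) \<nu>)"

lemma equivalent_probs_translate:
  assumes \<nu>: "\<nu> \<in> class_probs M" and T: "T \<in> measurable M M"
    and null: "null_sets (distr M M T) = null_sets M"
  shows "equivalent_probs (distr \<nu> \<nu> T) \<nu>"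
proof -
  from \<nu> have [simp]: "sets \<nu> = sets M" and n: "null_sets \<nu> = null_sets M" and "prob_space \<nu>"
    by (auto simp: class_probs_def)
  interpret prob_space \<nu> by fact
  have [simp]: "space \<nu> = space M" by (rule sets_eq_imp_space_eq) simp
  have T': "T \<in> measurable \<nu> \<nu>" using T by (simp cong: measurable_cong_sets)
  have "null_sets (distr \<nu> \<nu> T) = null_sets \<nu>"
  proof -
    have "A \<in> null_sets (distr \<nu> \<nu> T) \<longleftrightarrow> A \<in> null_sets \<nu>" for A
      using null_sets_distr_iff[OF T', of A] null_sets_distr_iff[OF T, of A] by (simp add: n null)
    then show ?thesis by blast
  qed
  then show ?thesis
    by (intro equivalent_probs.intro equivalent_probs_axioms.intro prob_space_distr T' prob_space_axioms)
      simp_all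
qed

context group
begin

text \<open>A probability mass function supported on the carrier, as a measure on the carrier. A \<open>pmf\<close> is a
  measure on the whole type, hence the restriction.\<close>

definition mass :: "'a pmf \<Rightarrow> 'a measure" where
  "mass p = restrict_space (measure_pmf p) (carrier G)"

lemma space_mass [simp]: "space (mass p) = carrier G"
  by (simp add: mass_def space_restrict_space)

lemma sets_mass [simp]: "sets (mass p) = Pow (carrier G)"
  by (auto simp: mass_def sets_restrict_space)

lemma measurable_mass [simp]: "h \<in> borel_measurable (mass p)"
  by (auto simp: measurable_def)

lemma integral_mass:
  fixes h :: "'a \<Rightarrow> real"
  assumes "set_pmf p = carrier G"
  shows "(\<integral>x. h x \<partial>mass p) = measure_pmf.expectation p h"
  unfolding mass_def using assms
  by (subst integral_restrict_space) (auto intro!: integral_cong_AE simp: AE_measure_pmf_iff)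

lemma AE_mass: 
  assumes "set_pmf p = carrier G"
  shows "(AE x in mass p. P x) \<longleftrightarrow> (\<forall>x\<in>carrier G. P x)"
  unfolding mass_def using assms
  by (subst AE_restrict_space_iff) (auto simp: AE_measure_pmf_iff)

lemma prob_space_mass:
  assumes "set_pmf p = carrier G"
  shows "prob_space (mass p)"
  unfolding mass_def using assms
  by (intro prob_space_restrict_space) (auto simp: measure_pmf.emeasure_eq_1_AE AE_measure_pmf_iff)

lemma null_sets_mass:
  assumes "set_pmf p = carrier G"
  shows "null_sets (mass p) = {{}}"
proof -
  have "A = {}" if A: "A \<in> null_sets (mass p)" for A
    using AE_not_in[OF A] null_setsD2[OF A] unfolding AE_mass[OF assms] by auto
  then show ?thesis by auto
qed

lemma mass_in_class_probs:
  assumes "set_pmf p = carrier G"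
  shows "mass p \<in> class_probs (count_space (carrier G))"
  using assms by (simp add: class_probs_def prob_space_mass null_sets_mass null_sets_count_space)

lemma left_translation_measurable:
  assumes "g \<in> carrier G"
  shows "left_translation G g \<in> measurable (count_space (carrier G)) (count_space (carrier G))"
  using assms by (auto simp: left_translation_def)

lemma null_sets_left_translation:
  assumes g: "g \<in> carrier G"
  shows "null_sets (distr (count_space (carrier G)) (count_space (carrier G)) (left_translation G g)) =
    null_sets (count_space (carrier G))"
proof -
  have "A = {}" if "left_translation G g -` A \<inter> carrier G = {}" "A \<subseteq> carrier G" for A
  proof (rule ccontr)
    assume "A \<noteq> {}"
    then obtain x where x: "x \<in> A" by blast
    with that have "x \<in> carrier G" by blast
    then have "inv g \<otimes> x \<in> left_translation G g -` A \<inter> carrier G"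
      using g x by (simp add: left_translation_def m_assoc[symmetric])
    with that show False by simp
  qed
  note surj = this
  have "A \<in> null_sets (distr (count_space (carrier G)) (count_space (carrier G)) (left_translation G g)) \<longleftrightarrow>
      A \<in> null_sets (count_space (carrier G))" for A
    by (simp add: null_sets_distr_iff[OF left_translation_measurable[OF g]] null_sets_count_space)
      (use surj[of A] in blast)
  then show ?thesis by blast
qed

lemma equivalent_probs_left_translation:
  assumes "\<nu> \<in> class_probs (count_space (carrier G))" "g \<in> carrier G"
  shows "equivalent_probs (distr \<nu> \<nu> (left_translation G g)) \<nu>"
  by (rule equivalent_probs_translate[OF assms(1) left_translation_measurable null_sets_left_translation])
    (use assms in auto)

lemma integral_mass_translate:
  fixes h :: "'a \<Rightarrow> real"
  assumes p: "set_pmf p = carrier G" and g: "g \<in> carrier G"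
  shows "(\<integral>x. h x \<partial>distr (mass p) (mass p) (left_translation G g)) =
    measure_pmf.expectation p (\<lambda>x. h (g \<otimes> x))"
proof -
  have "(\<integral>x. h x \<partial>distr (mass p) (mass p) (left_translation G g)) =
      (\<integral>x. h (left_translation G g x) \<partial>mass p)"
    using g by (intro integral_distr) (auto simp: measurable_def left_translation_def)
  also have "\<dots> = (\<integral>x. h (g \<otimes> x) \<partial>mass p)"
    by (intro Bochner_Integration.integral_cong) (auto simp: left_translation_def)
  also have "\<dots> = measure_pmf.expectation p (\<lambda>x. h (g \<otimes> x))" by (rule integral_mass[OF p])
  finally show ?thesis .
qed

lemma RN_deriv_mass:
  assumes p: "bounded_ratio T (real (Suc n)) p" and T: "T \<subseteq> carrier G" "inv g \<in> T" "g \<in> T"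
    and x: "x \<in> carrier G"
  shows "enn2real (RN_deriv (mass p) (distr (mass p) (mass p) (left_translation G g)) x) \<in> window n"
proof -
  have set_p: "set_pmf p = carrier G" using p by (simp add: bounded_ratio_def)
  have g: "g \<in> carrier G" using T by auto
  interpret equivalent_probs "distr (mass p) (mass p) (left_translation G g)" "mass p"
    by (rule equivalent_probs_left_translation[OF mass_in_class_probs[OF set_p] g])
  have "pmf p (inv g \<otimes> x) = measure_pmf.expectation p (\<lambda>y. indicator {x} (g \<otimes> y))"
  proof (subst integral_measure_pmf_real[of "{inv g \<otimes> x}"])
    show "y \<in> {inv g \<otimes> x}" if "y \<in> set_pmf p" "indicat_real {x} (g \<otimes> y) \<noteq> 0" for y
      using that g x set_p by (auto simp: indicator_def m_assoc[symmetric] split: if_splits)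
  qed (use g x in \<open>auto simp: m_assoc[symmetric]\<close>)
  also have "\<dots> = measure_pmf.expectation p (\<lambda>y. r y * indicator {x} y)"
    unfolding integral_mass_translate[OF set_p g, symmetric] integral_mass[OF set_p, symmetric]
    by (rule integral_P) simp
  also have "\<dots> = r x * pmf p x"
    by (subst integral_measure_pmf_real[of "{x}"]) (auto simp: indicator_def)
  finally have eq: "pmf p (inv g \<otimes> x) = r x * pmf p x" .
  have pos: "0 < pmf p x" using x set_p by (simp add: pmf_positive_iff)
  have "r x * pmf p x \<le> real (Suc n) * pmf p x"
    using p T x unfolding eq[symmetric] bounded_ratio_def by blast
  then have "r x \<le> real (Suc n)" using pos by simp
  moreover have "pmf p (g \<otimes> (inv g \<otimes> x)) \<le> real (Suc n) * pmf p (inv g \<otimes> x)"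
    using p T x g unfolding bounded_ratio_def by blast
  then have "1 * pmf p x \<le> (real (Suc n) * r x) * pmf p x"
    using g x by (simp add: m_assoc[symmetric] eq)
  then have "1 \<le> real (Suc n) * r x" using pos by (simp only: mult_le_cancel_right_pos)
  then have "inverse (real (Suc n)) \<le> r x" by (simp add: field_simps)
  ultimately show ?thesis by (simp add: window_def)
qed

end

text \<open>The data of the entropy of measures on \<open>G\<close>: the step distribution \<open>lam\<close> and a finite symmetric
  set \<open>T\<close> of group elements that contains its support.\<close>

locale translation_entropy = group G + entropy_generator f a
  for G :: "('g, 'm) monoid_scheme" (structure) and f a +
  fixes lam :: "'g pmf" and T :: "'g set"
  assumes finite_T: "finite T" and T_carrier: "T \<subseteq> carrier G" and set_lam: "set_pmf lam \<subseteq> T"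
    and T_inv: "\<And>g. g \<in> T \<Longrightarrow> inv g \<in> T"
begin

text \<open>A field \<open>x\<close> assigns to every pair \<open>(g, h)\<close> of group elements the coefficients \<open>(u, v)\<close> of a line
  \<open>u * t + v\<close>. When all these lines lie below \<open>f\<close>, the expectation of \<open>payoff x\<close> under a measure on
  \<open>G\<close> is a lower bound for its entropy. The translation of \<open>y\<close> by \<open>g\<close> in the first component
  comes from integrating \<open>u\<close> against the translated measure.\<close>

definition payoff :: "('g \<times> 'g \<Rightarrow> real \<times> real) \<Rightarrow> 'g \<Rightarrow> real" where
  "payoff x y = (\<Sum>g\<in>set_pmf lam. pmf lam g * (fst (x (g, g \<otimes> y)) + snd (x (g, y))))"

text \<open>The lines below \<open>f\<close> with coefficients bounded by \<open>B\<close>. This is a compact convex set.\<close>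

definition tangent_pairs :: "real \<Rightarrow> (real \<times> real) set" where
  "tangent_pairs B = {z. \<bar>fst z\<bar> \<le> B \<and> \<bar>snd z\<bar> \<le> B \<and> (\<forall>s>0. fst z * s + snd z \<le> f s)}"

lemma finite_lam: "finite (set_pmf lam)"
  using finite_T set_lam finite_subset by blast

lemma sum_lam: "(\<Sum>g\<in>set_pmf lam. pmf lam g) = 1"
  by (rule sum_pmf_eq_1) (auto intro: finite_lam)

lemma compact_tangent_pairs: "compact (tangent_pairs B)"
proof -
  have "closed {z :: real \<times> real. fst z * s + snd z \<le> f s}" for s
    by (intro closed_Collect_le continuous_intros)
  then have "closed (\<Inter>s\<in>{0<..}. {z :: real \<times> real. fst z * s + snd z \<le> f s})" by blast
  moreover have "compact ({-B..B} \<times> {-B..B})" by (intro compact_Times compact_Icc)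
  ultimately have "compact (({-B..B} \<times> {-B..B}) \<inter> (\<Inter>s\<in>{0<..}. {z :: real \<times> real. fst z * s + snd z \<le> f s}))"
    by (rule compact_Int_closed[rotated])
  also have "\<dots> = tangent_pairs B" by (auto simp: tangent_pairs_def abs_le_iff)
  finally show ?thesis .
qed

lemma abs_payoff_le:
  assumes "\<And>i. x i \<in> tangent_pairs B"
  shows "\<bar>payoff x y\<bar> \<le> 2 * B"
proof -
  have "\<bar>payoff x y\<bar> \<le> (\<Sum>g\<in>set_pmf lam. pmf lam g * (2 * B))"
    unfolding payoff_def
  proof (rule order_trans[OF sum_abs], rule sum_mono)
    fix g
    have "\<bar>fst (x (g, g \<otimes> y)) + snd (x (g, y))\<bar> \<le> 2 * B"
      using assms[of "(g, g \<otimes> y)"] assms[of "(g, y)"] by (auto simp: tangent_pairs_def)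
    then show "\<bar>pmf lam g * (fst (x (g, g \<otimes> y)) + snd (x (g, y)))\<bar> \<le> pmf lam g * (2 * B)"
      by (simp add: abs_mult mult_left_mono)
  qed
  then show ?thesis by (simp only: sum_distrib_right[symmetric] sum_lam mult_1)
qed

lemma integrable_payoff:
  assumes "\<And>i. x i \<in> tangent_pairs B"
  shows "integrable (measure_pmf p) (\<lambda>y. payoff x (h y))"
  by (rule measure_pmf.integrable_const_bound[where B = "2 * B"]) (use abs_payoff_le[OF assms] in auto)

lemma expectation_payoff:
  assumes x: "\<And>i. x i \<in> tangent_pairs B" and p: "bounded_ratio T (real (Suc n)) p"
  shows "measure_pmf.expectation p (payoff x) = (\<Sum>g\<in>set_pmf lam. pmf lam g *
    (\<integral>y. fst (x (g, y)) * enn2real (RN_deriv (mass p) (distr (mass p) (mass p) (left_translation G g)) y)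
      + snd (x (g, y)) \<partial>mass p))"
proof -
  have set_p: "set_pmf p = carrier G" using p by (simp add: bounded_ratio_def)
  have int: "integrable (measure_pmf p) (\<lambda>y. fst (x (g, g \<otimes> y)))"
    "integrable (measure_pmf p) (\<lambda>y. snd (x (g, y)))" for g
    using x by (auto intro!: measure_pmf.integrable_const_bound[where B = B] simp: tangent_pairs_def)
  have "measure_pmf.expectation p (payoff x) = (\<Sum>g\<in>set_pmf lam. pmf lam g *
      (measure_pmf.expectation p (\<lambda>y. fst (x (g, g \<otimes> y))) + measure_pmf.expectation p (\<lambda>y. snd (x (g, y)))))"
    unfolding payoff_def using int by (subst Bochner_Integration.integral_sum) auto
  also have "\<dots> = (\<Sum>g\<in>set_pmf lam. pmf lam g *
    (\<integral>y. fst (x (g, y)) * enn2real (RN_deriv (mass p) (distr (mass p) (mass p) (left_translation G g)) y)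
      + snd (x (g, y)) \<partial>mass p))"
  proof (intro sum.cong refl arg_cong[where f = "\<lambda>z. pmf lam _ * z"])
    fix g assume "g \<in> set_pmf lam"
    then have g: "g \<in> carrier G" using set_lam T_carrier by auto
    interpret E: equivalent_probs "distr (mass p) (mass p) (left_translation G g)" "mass p"
      by (rule equivalent_probs_left_translation[OF mass_in_class_probs[OF set_p] g])
    have "(\<lambda>y. fst (x (g, y))) \<in> L_infty (mass p)" "(\<lambda>y. snd (x (g, y))) \<in> L_infty (mass p)"
      using x by (auto simp: L_infty_def tangent_pairs_def intro!: exI[of _ B])
    from E.integral_tangent(2)[OF this]
    show "measure_pmf.expectation p (\<lambda>y. fst (x (g, g \<otimes> y))) + measure_pmf.expectation p (\<lambda>y. snd (x (g, y)))
      = (\<integral>y. fst (x (g, y)) * E.r y + snd (x (g, y)) \<partial>mass p)"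
      by (simp add: integral_mass_translate[OF set_p g] integral_mass[OF set_p])
  qed
  finally show ?thesis .
qed

text \<open>The bound depends on the measure only through \<open>n\<close>, so it is uniform over all right translates of
  one measure.\<close>

lemma expectation_payoff_le:
  assumes x: "\<And>i. x i \<in> tangent_pairs B" and p: "bounded_ratio T (real (Suc n)) p"
  shows "measure_pmf.expectation p (payoff x) \<le> slope_bound n * (real (Suc n) + 1)"
proof -
  have set_p: "set_pmf p = carrier G" using p by (simp add: bounded_ratio_def)
  have "measure_pmf.expectation p (payoff x) \<le> (\<Sum>g\<in>set_pmf lam. pmf lam g * (slope_bound n * (real (Suc n) + 1)))"
    unfolding expectation_payoff[OF x p]
  proof (intro sum_mono mult_left_mono pmf_nonneg)
    fix g assume g: "g \<in> set_pmf lam"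
    then have gT: "g \<in> T" "inv g \<in> T" and gG: "g \<in> carrier G" using set_lam T_carrier T_inv by auto
    interpret E: equivalent_probs "distr (mass p) (mass p) (left_translation G g)" "mass p"
      by (rule equivalent_probs_left_translation[OF mass_in_class_probs[OF set_p] gG])
    have L: "(\<lambda>y. fst (x (g, y))) \<in> L_infty (mass p)" "(\<lambda>y. snd (x (g, y))) \<in> L_infty (mass p)"
      using x by (auto simp: L_infty_def tangent_pairs_def intro!: exI[of _ B])
    have "AE y in mass p. fst (x (g, y)) * E.r y + snd (x (g, y)) \<le> slope_bound n * (real (Suc n) + 1)"
      unfolding AE_mass[OF set_p]
    proof
      fix y assume "y \<in> carrier G"
      then have window: "E.r y \<in> window n" by (intro RN_deriv_mass[OF p T_carrier gT(2,1)])
      have "fst (x (g, y)) * E.r y + snd (x (g, y)) \<le> f (E.r y)"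
        using x[of "(g, y)"] window_pos[OF window] by (auto simp: tangent_pairs_def)
      also have "\<dots> \<le> slope_bound n * (real (Suc n) + 1)" by (rule generator_le_on_window[OF window])
      finally show "fst (x (g, y)) * E.r y + snd (x (g, y)) \<le> slope_bound n * (real (Suc n) + 1)" .
    qed
    then have "(\<integral>y. fst (x (g, y)) * E.r y + snd (x (g, y)) \<partial>mass p) \<le>
        (\<integral>y. slope_bound n * (real (Suc n) + 1) \<partial>mass p)"
      by (intro integral_mono_AE E.integral_tangent(1)[OF L]) auto
    then show "(\<integral>y. fst (x (g, y)) * E.r y + snd (x (g, y)) \<partial>mass p) \<le> slope_bound n * (real (Suc n) + 1)"
      using E.Q.prob_space by simp
  qed
  then show ?thesis by (simp only: sum_distrib_right[symmetric] sum_lam mult_1)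
qed

lemma zero_tangent_pair: "0 \<le> B \<Longrightarrow> (0, 0) \<in> tangent_pairs B"
  using nonneg by (auto simp: tangent_pairs_def)

text \<open>Choosing in each point the line that touches \<open>f\<close> at the derivative, one attains the entropy.\<close>

lemma expectation_payoff_touch:
  assumes p: "bounded_ratio T (real (Suc n)) p"
  shows "\<exists>x. (\<forall>i. x i \<in> tangent_pairs (window_bound n)) \<and> 0 \<le> measure_pmf.expectation p (payoff x) \<and>
    ennreal (measure_pmf.expectation p (payoff x)) = entropy_sum (left_translation G) lam f (mass p)"
proof -
  have set_p: "set_pmf p = carrier G" using p by (simp add: bounded_ratio_def)
  define R where "R g y = enn2real (RN_deriv (mass p) (distr (mass p) (mass p) (left_translation G g)) y)" for g y
  define x where "x = (\<lambda>(g, y). (slope n (R g y), intercept n (R g y)))"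
  have x: "x i \<in> tangent_pairs (window_bound n)" for i
    by (auto simp: x_def tangent_pairs_def abs_slope_le_window_bound abs_intercept_le window_tangent split: prod.splits)
  have touch: "fst (x (g, y)) * R g y + snd (x (g, y)) = f (R g y) \<and> 0 \<le> f (R g y)"
    if "g \<in> set_pmf lam" "y \<in> carrier G" for g y
  proof -
    have "R g y \<in> window n"
      unfolding R_def using that set_lam T_inv by (intro RN_deriv_mass[OF p T_carrier]) auto
    from window_tangent_touch[OF this] nonneg[OF window_pos[OF this]] show ?thesis by (simp add: x_def)
  qed
  have D: "f_divergence f (distr (mass p) (mass p) (left_translation G g)) (mass p) =
      ennreal (\<integral>y. fst (x (g, y)) * R g y + snd (x (g, y)) \<partial>mass p)"
    and D_nonneg: "0 \<le> (\<integral>y. fst (x (g, y)) * R g y + snd (x (g, y)) \<partial>mass p)"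
    if g: "g \<in> set_pmf lam" for g
  proof -
    have gG: "g \<in> carrier G" using g set_lam T_carrier by auto
    interpret E: equivalent_probs "distr (mass p) (mass p) (left_translation G g)" "mass p"
      by (rule equivalent_probs_left_translation[OF mass_in_class_probs[OF set_p] gG])
    have L: "(\<lambda>y. fst (x (g, y))) \<in> L_infty (mass p)" "(\<lambda>y. snd (x (g, y))) \<in> L_infty (mass p)"
      using x by (auto simp: L_infty_def tangent_pairs_def intro!: exI[of _ "window_bound n"])
    have nonneg: "AE y in mass p. 0 \<le> fst (x (g, y)) * R g y + snd (x (g, y))"
      unfolding AE_mass[OF set_p] using touch[OF g] by simp
    then show "0 \<le> (\<integral>y. fst (x (g, y)) * R g y + snd (x (g, y)) \<partial>mass p)"
      by (rule integral_nonneg_AE)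
    have "f_divergence f (distr (mass p) (mass p) (left_translation G g)) (mass p) =
        (\<integral>\<^sup>+ y. ennreal (fst (x (g, y)) * R g y + snd (x (g, y))) \<partial>mass p)"
      unfolding f_divergence_def R_def[symmetric]
      by (intro nn_integral_cong) (simp add: touch[OF g])
    also have "\<dots> = ennreal (\<integral>y. fst (x (g, y)) * R g y + snd (x (g, y)) \<partial>mass p)"
      by (rule nn_integral_eq_integral[OF E.integral_tangent(1)[OF L, folded R_def] nonneg])
    finally show "f_divergence f (distr (mass p) (mass p) (left_translation G g)) (mass p) =
      ennreal (\<integral>y. fst (x (g, y)) * R g y + snd (x (g, y)) \<partial>mass p)" .
  qed
  have E: "measure_pmf.expectation p (payoff x) =
      (\<Sum>g\<in>set_pmf lam. pmf lam g * (\<integral>y. fst (x (g, y)) * R g y + snd (x (g, y)) \<partial>mass p))"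
    unfolding R_def by (rule expectation_payoff[OF x p])
  have "entropy_sum (left_translation G) lam f (mass p) = (\<Sum>g\<in>set_pmf lam.
      ennreal (pmf lam g * (\<integral>y. fst (x (g, y)) * R g y + snd (x (g, y)) \<partial>mass p)))"
    unfolding entropy_sum_def by (intro sum.cong refl) (simp add: D D_nonneg ennreal_mult)
  also have "\<dots> = ennreal (measure_pmf.expectation p (payoff x))"
    unfolding E by (rule sum_ennreal) (simp add: D_nonneg)
  finally show ?thesis
    using x by (intro exI[of _ x]) (auto simp: E intro!: sum_nonneg mult_nonneg_nonneg D_nonneg)
qed

lemma continuous_on_payoff: "continuous_on X (\<lambda>x. payoff x y)"
proof -
  have "continuous_on X (\<lambda>x :: 'g \<times> 'g \<Rightarrow> real \<times> real. x i)" for i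
    by (rule continuous_on_subset[OF continuous_on_product_coordinates]) simp
  then show ?thesis unfolding payoff_def by (intro continuous_intros)
qed

lemma payoff_convex_combination:
  "payoff (\<lambda>i. x i + \<tau> *\<^sub>R (y i - x i)) h = payoff x h + \<tau> * (payoff y h - payoff x h)"
  unfolding payoff_def sum_subtractf[symmetric] sum_distrib_left sum.distrib[symmetric]
  by (intro sum.cong refl) (simp add: algebra_simps)

lemma tangent_pairs_convex:
  assumes u: "u \<in> tangent_pairs B" and v: "v \<in> tangent_pairs B" and \<tau>: "0 \<le> \<tau>" "\<tau> \<le> 1"
  shows "u + \<tau> *\<^sub>R (v - u) \<in> tangent_pairs B"
proof -
  have le: "p + \<tau> * (q - p) \<le> c" if "p \<le> c" "q \<le> c" for p q c :: real
  proof -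
    have "p + \<tau> * (q - p) = (1 - \<tau>) * p + \<tau> * q" by (simp add: algebra_simps)
    also have "\<dots> \<le> (1 - \<tau>) * c + \<tau> * c" using that \<tau> by (intro add_mono mult_left_mono) auto
    finally show ?thesis by (simp add: algebra_simps)
  qed
  have abs: "\<bar>p + \<tau> * (q - p)\<bar> \<le> B" if "\<bar>p\<bar> \<le> B" "\<bar>q\<bar> \<le> B" for p q
    using le[of p B q] le[of "-p" B "-q"] that by (simp add: abs_le_iff algebra_simps)
  have "(fst u + \<tau> * (fst v - fst u)) * s + (snd u + \<tau> * (snd v - snd u)) \<le> f s" if "0 < s" for s
  proof -
    have "(fst u * s + snd u) + \<tau> * ((fst v * s + snd v) - (fst u * s + snd u)) \<le> f s"
      using u v that by (intro le) (auto simp: tangent_pairs_def)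
    then show ?thesis by (simp add: algebra_simps)
  qed
  then show ?thesis using u v abs by (auto simp: tangent_pairs_def)
qed

lemma expectation_payoff_lazy:
  assumes x: "\<And>i. x i \<in> tangent_pairs B" and k: "k \<in> carrier G" and t: "0 \<le> t" "t \<le> 1"
  shows "measure_pmf.expectation (map_pmf (\<lambda>y. y \<otimes> k) (lazy t \<kappa>)) (payoff x) =
    t * measure_pmf.expectation (map_pmf (\<lambda>y. y \<otimes> k) \<kappa>) (payoff x) + (1 - t) * payoff x k"
  unfolding integral_map_pmf lazy_def
  by (subst expectation_bind_pmf[OF abs_payoff_le[OF x]]) (use k t in simp)

lemma exists_pmf_of_weights:
  fixes \<mu> :: "'k \<Rightarrow> real"
  assumes "finite K" "\<And>k. k \<in> K \<Longrightarrow> 0 \<le> \<mu> k" "sum \<mu> K = 1"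
  shows "\<exists>p. set_pmf p \<subseteq> K \<and> (\<forall>k\<in>K. pmf p k = \<mu> k)"
proof -
  define m where "m k = (if k \<in> K then \<mu> k else 0)" for k
  have m: "0 \<le> m k" for k using assms(2) by (simp add: m_def)
  have "(\<integral>\<^sup>+ k. ennreal (m k) \<partial>count_space UNIV) = (\<Sum>k\<in>K. ennreal (m k))"
    using assms(1) by (intro nn_integral_count_space') (auto simp: m_def)
  also have "\<dots> = ennreal (\<Sum>k\<in>K. m k)" by (rule sum_ennreal) (rule m)
  also have "(\<Sum>k\<in>K. m k) = 1" using assms(3) by (simp add: m_def)
  finally have eq: "pmf (embed_pmf m) k = m k" for k using m by (intro pmf_embed_pmf) auto
  show ?thesis by (rule exI[of _ "embed_pmf m"]) (auto simp: set_pmf_eq eq m_def)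
qed

text \<open>Duality on \<open>G\<close>: a lower bound \<open>I\<close> for the entropy of all measures on \<open>G\<close> is, up to an error that
  vanishes as \<open>t \<rightarrow> 0\<close>, a pointwise lower bound for \<open>payoff x\<close> for a single field \<open>x\<close> of lines below \<open>f\<close>.

  The minimax theorem is applied to the right translates \<open>q k\<close> of \<open>lazy t \<kappa>\<close>. Point masses cannot be
  used directly, since the derivatives of their translates are degenerate. The measures \<open>q k\<close> and all their
  mixtures have derivatives in one interval \<open>window n\<close>, so the touching lines have coefficients in
  one compact set.\<close>

lemma exists_dual_optimum:
  assumes I: "\<And>p. set_pmf p = carrier G \<Longrightarrow> ennreal I \<le> entropy_sum (left_translation G) lam f (mass p)"
    and \<kappa>: "bounded_ratio T (real (Suc m)) \<kappa>" and t: "0 < t" "t < 1"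
  shows "\<exists>x B. (\<forall>i. x i \<in> tangent_pairs B) \<and> (\<forall>k\<in>carrier G.
    I \<le> t * (slope_bound m * (real (Suc m) + 1)) + (1 - t) * payoff x k)"
proof -
  obtain N where "bounded_ratio T N (lazy t \<kappa>)"
    using bounded_ratio_lazy[OF \<kappa> t finite_T T_carrier] by blast
  moreover obtain n where "N \<le> real n" using real_arch_simple by blast
  ultimately have lazy: "bounded_ratio T (real (Suc n)) (lazy t \<kappa>)"
    by (auto intro: bounded_ratio_mono)
  define B where "B = window_bound n"
  define q where "q k = map_pmf (\<lambda>y. y \<otimes> k) (lazy t \<kappa>)" for k
  define D :: "('g \<times> 'g \<Rightarrow> real \<times> real) set" where "D = {x. \<forall>i. x i \<in> tangent_pairs B}"
  have q: "bounded_ratio T (real (Suc n)) (q k)" if "k \<in> carrier G" for k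
    unfolding q_def by (rule bounded_ratio_translate[OF lazy that T_carrier])
  have "\<exists>x\<in>D. \<forall>k\<in>carrier G. I \<le> measure_pmf.expectation (q k) (payoff x)"
  proof (rule minimax[where W = "\<lambda>k x. measure_pmf.expectation (q k) (payoff x)"])
    show "compact D" unfolding D_def by (rule compact_Pi) (rule compact_tangent_pairs)
    show "closed D"
      unfolding D_def by (intro closed_Pi compact_imp_closed compact_tangent_pairs)
    have "0 \<le> B" using abs_slope_le_window_bound[of n 1] by (simp add: B_def)
    then have "(\<lambda>_. (0, 0)) \<in> D" by (simp add: D_def zero_tangent_pair)
    then show "D \<noteq> {}" by blast
    show "continuous_on D (\<lambda>x. measure_pmf.expectation (q k) (payoff x))" for k
      by (rule continuous_on_expectation[OF continuous_on_payoff], rule abs_payoff_le) (auto simp: D_def)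
  next
    fix x y and \<tau> :: real assume xy: "x \<in> D" "y \<in> D" and \<tau>: "0 \<le> \<tau>" "\<tau> \<le> 1"
    define z where "z i = x i + \<tau> *\<^sub>R (y i - x i)" for i
    have "z \<in> D" using xy \<tau> by (simp add: D_def z_def tangent_pairs_convex)
    moreover have "measure_pmf.expectation (q k) (payoff z) = measure_pmf.expectation (q k) (payoff x)
        + \<tau> * (measure_pmf.expectation (q k) (payoff y) - measure_pmf.expectation (q k) (payoff x))" for k
    proof -
      have "integrable (measure_pmf (q k)) (payoff x)" "integrable (measure_pmf (q k)) (payoff y)"
        using integrable_payoff[of x B "q k" "\<lambda>y. y"] integrable_payoff[of y B "q k" "\<lambda>y. y"] xy by (auto simp: D_def)
      moreover have "payoff z = (\<lambda>h. payoff x h + \<tau> * (payoff y h - payoff x h))"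
        unfolding z_def by (rule ext) (rule payoff_convex_combination)
      ultimately show ?thesis by simp
    qed
    ultimately show "\<exists>z\<in>D. \<forall>k\<in>carrier G. measure_pmf.expectation (q k) (payoff z) =
        measure_pmf.expectation (q k) (payoff x)
        + \<tau> * (measure_pmf.expectation (q k) (payoff y) - measure_pmf.expectation (q k) (payoff x))"
      by blast
  next
    fix K and w :: "'g \<Rightarrow> real"
    assume K: "finite K" "K \<subseteq> carrier G" and w: "\<And>k. k \<in> K \<Longrightarrow> 0 \<le> w k" "sum w K = 1"
    obtain \<mu> where \<mu>: "set_pmf \<mu> \<subseteq> K" "\<And>k. k \<in> K \<Longrightarrow> pmf \<mu> k = w k"
      using exists_pmf_of_weights[OF K(1) w] by blast
    define p where "p = bind_pmf \<mu> q"
    have p: "bounded_ratio T (real (Suc n)) p"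
      unfolding p_def by (rule bounded_ratio_bind) (use \<mu> K q in blast)
    then have set_p: "set_pmf p = carrier G" by (simp add: bounded_ratio_def)
    obtain x where x: "\<forall>i. x i \<in> tangent_pairs B" "0 \<le> measure_pmf.expectation p (payoff x)"
      "ennreal (measure_pmf.expectation p (payoff x)) = entropy_sum (left_translation G) lam f (mass p)"
      using expectation_payoff_touch[OF p] unfolding B_def by blast
    have "I \<le> measure_pmf.expectation p (payoff x)"
      using I[OF set_p] x(2) unfolding x(3)[symmetric] by (simp add: ennreal_le_iff)
    also have "\<dots> = measure_pmf.expectation \<mu> (\<lambda>k. measure_pmf.expectation (q k) (payoff x))"
      unfolding p_def by (rule expectation_bind_pmf[OF abs_payoff_le]) (use x in auto)
    also have "\<dots> = (\<Sum>k\<in>K. w k * measure_pmf.expectation (q k) (payoff x))"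
      using \<mu> by (subst integral_measure_pmf_real[OF K(1)]) (auto simp: mult.commute intro!: sum.cong)
    finally show "\<exists>x\<in>D. I \<le> (\<Sum>k\<in>K. w k * measure_pmf.expectation (q k) (payoff x))"
      using x(1) by (auto simp: D_def)
  qed
  then obtain x where x: "\<And>i. x i \<in> tangent_pairs B"
    and ge: "\<And>k. k \<in> carrier G \<Longrightarrow> I \<le> measure_pmf.expectation (q k) (payoff x)" by (auto simp: D_def)
  have "I \<le> t * (slope_bound m * (real (Suc m) + 1)) + (1 - t) * payoff x k" if k: "k \<in> carrier G" for k
  proof -
    have "I \<le> t * measure_pmf.expectation (map_pmf (\<lambda>y. y \<otimes> k) \<kappa>) (payoff x) + (1 - t) * payoff x k"
      using ge[OF k] t unfolding q_def by (subst (asm) expectation_payoff_lazy[OF x k]) auto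
    moreover have "measure_pmf.expectation (map_pmf (\<lambda>y. y \<otimes> k) \<kappa>) (payoff x) \<le> slope_bound m * (real (Suc m) + 1)"
      by (rule expectation_payoff_le[OF x bounded_ratio_translate[OF \<kappa> k T_carrier]])
    ultimately show ?thesis using t by (smt (verit) mult_left_mono)
  qed
  with x show ?thesis by blast
qed

end

section \<open>Comparison of the entropies on the group and on the space\<close>

lemma class_probsD:
  assumes "\<nu> \<in> class_probs M"
  shows "prob_space \<nu>" "sets \<nu> = sets M" "null_sets \<nu> = null_sets M" "space \<nu> = space M"
  using assms sets_eq_imp_space_eq[of \<nu> M] by (auto simp: class_probs_def)

lemma class_probs_AE_iff:
  assumes "\<nu> \<in> class_probs M"
  shows "(AE x in \<nu>. P x) \<longleftrightarrow> (AE x in M. P x)"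
  using class_probsD[OF assms] by (simp add: eventually_ae_filter)

lemma class_probs_L_infty:
  assumes "\<nu> \<in> class_probs M"
  shows "L_infty \<nu> = L_infty M"
  unfolding L_infty_def class_probs_AE_iff[OF assms]
    measurable_cong_sets[OF class_probsD(2)[OF assms] refl] ..

context g_space
begin

lemma equivalent_probs_act:
  assumes "\<nu> \<in> class_probs M" "g \<in> carrier G"
  shows "equivalent_probs (distr \<nu> \<nu> (act g)) \<nu>"
  by (rule equivalent_probs_translate) (use assms measurable_act invariant_class in auto)

text \<open>The inequality that needs no amenability. The average \<open>\<eta>\<close> of the translates of a measure \<open>\<nu>\<close> on
  \<open>M\<close> with respect to \<open>\<mu>\<close> is the image of \<open>\<mu> \<times> \<nu>\<close> under the equivariant map \<open>(h, s) \<mapsto> act h s\<close>,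
  so it has at most the entropy of \<open>\<mu>\<close>. In terms of the dual form of the divergence: a pair \<open>(A, B)\<close> of
  functions on \<open>M\<close> is averaged over \<open>\<nu>\<close> to a pair of functions on \<open>G\<close> with the same integrals.\<close>

lemma convolution_entropy_le:
  assumes \<mu>: "\<mu> \<in> class_probs (count_space (carrier G))"
    and gen: "entropy_generator f a" and lam: "set_pmf lam \<subseteq> carrier G"
  shows "\<exists>\<eta>\<in>class_probs M. entropy_sum act lam f \<eta> \<le> entropy_sum (left_translation G) lam f \<mu>"
proof -
  interpret entropy_generator f a by fact
  have group: "group G" by (rule group_hom.axioms(1)[OF group_hom])
  interpret G: group G by (rule group)
  obtain \<nu> where \<nu>: "\<nu> \<in> class_probs M" using class_probs_nonempty by blast
  interpret \<nu>: prob_space \<nu> by (rule class_probsD[OF \<nu>])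
  interpret \<mu>: prob_space \<mu> by (rule class_probsD[OF \<mu>])
  have [measurable_cong]: "sets \<nu> = sets M" and sp_\<nu>: "space \<nu> = space M" using class_probsD[OF \<nu>] by auto
  have sets_\<mu>: "sets \<mu> = sets (count_space (carrier G))" and sp_\<mu>: "space \<mu> = carrier G"
    using class_probsD[OF \<mu>] by auto
  have meas_\<mu>: "h \<in> measurable \<mu> N \<longleftrightarrow> h \<in> carrier G \<rightarrow> space N" for h and N :: "'z measure"
    unfolding measurable_cong_sets[OF sets_\<mu> refl] by simp
  have act_\<nu>: "act g \<in> measurable \<nu> M" if "g \<in> carrier G" for g
    using measurable_act[OF that] by simp
  define K where "K h = distr \<nu> M (act h)" for h
  have prob_K: "prob_space (K h)" if "h \<in> carrier G" for h
    unfolding K_def by (rule \<nu>.prob_space_distr[OF act_\<nu>[OF that]])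
  have K: "K \<in> measurable \<mu> (subprob_algebra M)"
  proof -
    have "K h \<in> space (subprob_algebra M)" if "h \<in> carrier G" for h
      using prob_space_imp_subprob_space[OF prob_K[OF that]] by (simp add: space_subprob_algebra K_def)
    then show ?thesis unfolding meas_\<mu> by auto
  qed
  have ne: "space \<mu> \<noteq> {}" by (rule \<mu>.not_empty)
  define \<eta> where "\<eta> = \<mu> \<bind> K"
  have sets_\<eta>: "sets \<eta> = sets M"
    unfolding \<eta>_def by (rule sets_bind[OF _ ne]) (simp add: K_def)
  interpret \<eta>: prob_space \<eta>
    unfolding \<eta>_def by (rule \<mu>.prob_space_bind[OF _ K]) (auto simp: sp_\<mu> prob_K)
  have null_K: "A \<in> null_sets (K h) \<longleftrightarrow> A \<in> null_sets M" if "h \<in> carrier G" for A h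
    using null_sets_distr_iff[OF act_\<nu>[OF that], of A] null_sets_distr_iff[OF measurable_act[OF that], of A]
    by (simp add: K_def sp_\<nu> class_probsD(3)[OF \<nu>] invariant_class[OF that])
  have "A \<in> null_sets \<eta> \<longleftrightarrow> A \<in> null_sets M" for A
  proof (cases "A \<in> sets M")
    case True
    have "A \<in> null_sets \<eta> \<longleftrightarrow> (\<integral>\<^sup>+ h. emeasure (K h) A \<partial>\<mu>) = 0"
      using True sets_\<eta> unfolding \<eta>_def null_sets_def by (simp add: emeasure_bind[OF ne K True])
    also have "\<dots> \<longleftrightarrow> (AE h in \<mu>. emeasure (K h) A = 0)"
      by (rule nn_integral_0_iff_AE) (simp add: meas_\<mu>)
    also have "\<dots> \<longleftrightarrow> (AE h in \<mu>. A \<in> null_sets M)"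
    proof (rule AE_cong)
      fix h assume "h \<in> space \<mu>"
      then show "emeasure (K h) A = 0 \<longleftrightarrow> A \<in> null_sets M"
        using null_K[of h A] True by (auto simp: sp_\<mu> null_sets_def K_def)
    qed
    also have "\<dots> \<longleftrightarrow> A \<in> null_sets M" by (simp add: \<mu>.AE_const)
    finally show ?thesis .
  qed (use sets_\<eta> in auto)
  then have "null_sets \<eta> = null_sets M" by blast
  then have \<eta>: "\<eta> \<in> class_probs M"
    by (simp add: class_probs_def sets_\<eta> \<eta>.prob_space_axioms)
  have sp_\<eta>: "space \<eta> = space M" by (rule class_probsD[OF \<eta>])
  \<comment> \<open>The averages of a function on \<open>M\<close> over the translates of \<open>\<nu>\<close>, as a function on \<open>G\<close>.\<close>
  define avg where "avg A h = (\<integral>s. A (act h s) \<partial>\<nu>)" for A :: "'a \<Rightarrow> real" and h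
  have int_\<eta>: "(\<integral>s. A s \<partial>\<eta>) = (\<integral>h. avg A h \<partial>\<mu>)"
    if A: "A \<in> borel_measurable M" and C: "\<And>x. \<bar>A x\<bar> \<le> C" for A C
  proof -
    have "(\<integral>s. A s \<partial>\<eta>) = (\<integral>h. (\<integral>s. A s \<partial>K h) \<partial>\<mu>)"
      unfolding \<eta>_def
      by (rule integral_bind[OF A C K \<mu>.finite_measure_axioms, of 1])
        (use prob_K in \<open>auto simp: sp_\<mu> intro!: AE_I2 prob_space.emeasure_le_1\<close>)
    also have "\<dots> = (\<integral>h. avg A h \<partial>\<mu>)"
      by (intro Bochner_Integration.integral_cong refl)
        (simp add: K_def avg_def sp_\<mu> integral_distr[OF act_\<nu> A])
    finally show ?thesis .
  qed
  have div: "f_divergence f (distr \<eta> \<eta> (act g)) \<eta> \<le> f_divergence f (distr \<mu> \<mu> (left_translation G g)) \<mu>"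
    if g: "g \<in> carrier G" for g
  proof -
    interpret X: equivalent_probs "distr \<eta> \<eta> (act g)" \<eta> by (rule equivalent_probs_act[OF \<eta> g])
    interpret Y: equivalent_probs "distr \<mu> \<mu> (left_translation G g)" \<mu>
      by (rule G.equivalent_probs_left_translation[OF \<mu> g])
    have act_\<eta>: "act g \<in> measurable \<eta> \<eta>"
      using measurable_act[OF g] measurable_cong_sets[OF sets_\<eta> sets_\<eta>] by simp
    show ?thesis
    proof (rule X.f_divergence_le[OF gen])
      fix A B :: "'a \<Rightarrow> real"
      assume "A \<in> borel_measurable \<eta>" "B \<in> borel_measurable \<eta>"
      then have A[measurable]: "A \<in> borel_measurable M" and B[measurable]: "B \<in> borel_measurable M"
        using measurable_cong_sets[OF sets_\<eta> refl] by auto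
      assume "\<exists>C. \<forall>x. \<bar>A x\<bar> \<le> C \<and> \<bar>B x\<bar> \<le> C"
      then obtain C where C: "\<And>x. \<bar>A x\<bar> \<le> C" "\<And>x. \<bar>B x\<bar> \<le> C" by blast
      assume tan: "\<And>x t. 0 < t \<Longrightarrow> A x * t + B x \<le> f t"
      have int: "integrable \<nu> (\<lambda>s. F (act h s))"
        if "h \<in> carrier G" "F \<in> borel_measurable M" "\<And>x. \<bar>F x\<bar> \<le> C" for F h
        by (rule \<nu>.integrable_const_bound[where B = C])
          (use that in \<open>auto intro: measurable_compose[OF act_\<nu>]\<close>)
      have avg_bdd: "\<bar>avg F h\<bar> \<le> C"
        if "h \<in> carrier G" "F \<in> borel_measurable M" "\<And>x. \<bar>F x\<bar> \<le> C" for F h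
      proof -
        have "\<bar>avg F h\<bar> \<le> (\<integral>s. \<bar>F (act h s)\<bar> \<partial>\<nu>)" unfolding avg_def by (rule integral_abs_bound)
        also have "\<dots> \<le> (\<integral>s. C \<partial>\<nu>)" using int[OF that] that(3) by (intro integral_mono) auto
        finally show ?thesis using \<nu>.prob_space by simp
      qed
      have L: "avg A \<in> L_infty \<mu>" "avg B \<in> L_infty \<mu>"
        using avg_bdd[OF _ A C(1)] avg_bdd[OF _ B C(2)]
        by (auto simp: L_infty_def meas_\<mu> sp_\<mu> intro!: exI[of _ C] AE_I2)
      have "(\<integral>s. A s \<partial>distr \<eta> \<eta> (act g)) = (\<integral>s. A (act g s) \<partial>\<eta>)"
        by (rule integral_distr[OF act_\<eta>]) (use \<open>A \<in> borel_measurable \<eta>\<close> in simp)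
      also have "\<dots> = (\<integral>h. avg (\<lambda>s. A (act g s)) h \<partial>\<mu>)"
        by (rule int_\<eta>[OF measurable_compose[OF measurable_act[OF g] A]]) (rule C)
      also have "\<dots> = (\<integral>h. avg A (left_translation G g h) \<partial>\<mu>)"
      proof (intro Bochner_Integration.integral_cong refl)
        fix h assume "h \<in> space \<mu>"
        then have h: "h \<in> carrier G" by (simp add: sp_\<mu>)
        show "avg (\<lambda>s. A (act g s)) h = avg A (left_translation G g h)"
          unfolding avg_def using h g
          by (intro Bochner_Integration.integral_cong refl)
            (simp add: left_translation_def sp_\<nu> composition_rule)
      qed
      also have "\<dots> = (\<integral>h. avg A h \<partial>distr \<mu> \<mu> (left_translation G g))"
        using g by (intro integral_distr[symmetric])
          (auto simp: meas_\<mu> sp_\<mu> left_translation_def)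
      finally have "(\<integral>s. A s \<partial>distr \<eta> \<eta> (act g)) + (\<integral>s. B s \<partial>\<eta>) =
          (\<integral>h. avg A h \<partial>distr \<mu> \<mu> (left_translation G g)) + (\<integral>h. avg B h \<partial>\<mu>)"
        using int_\<eta>[OF B C(2)] by simp
      also have "ennreal \<dots> \<le> f_divergence f (distr \<mu> \<mu> (left_translation G g)) \<mu>"
      proof (rule Y.f_divergence_ge[OF L])
        show "AE h in \<mu>. avg A h * Y.r h + avg B h \<le> f (Y.r h)"
          using Y.r_pos AE_space
        proof eventually_elim
          fix h assume pos: "0 < Y.r h" and "h \<in> space \<mu>"
          then have h: "h \<in> carrier G" by (simp add: sp_\<mu>)
          note iA = int[OF h A C(1)] and iB = int[OF h B C(2)]
          have "avg A h * Y.r h + avg B h = (\<integral>s. A (act h s) * Y.r h + B (act h s) \<partial>\<nu>)"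
            unfolding avg_def using iA iB by simp
          also have "\<dots> \<le> (\<integral>s. f (Y.r h) \<partial>\<nu>)"
            using iA iB by (intro integral_mono tan[OF pos]) auto
          finally show "avg A h * Y.r h + avg B h \<le> f (Y.r h)" using \<nu>.prob_space by simp
        qed
      qed
      finally show "ennreal ((\<integral>s. A s \<partial>distr \<eta> \<eta> (act g)) + (\<integral>s. B s \<partial>\<eta>))
        \<le> f_divergence f (distr \<mu> \<mu> (left_translation G g)) \<mu>" .
    qed
  qed
  have "entropy_sum act lam f \<eta> \<le> entropy_sum (left_translation G) lam f \<mu>"
    unfolding entropy_sum_def using lam by (intro sum_mono mult_left_mono div) auto
  with \<eta> show ?thesis by blast
qed

end

lemma lift_L_infty:
  assumes "\<And>h. \<bar>\<phi> h\<bar> \<le> C"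
  shows "(\<lambda>y. \<phi> (fst y)) \<in> L_infty (count_space X \<Otimes>\<^sub>M S)"
proof -
  have "(\<lambda>y. \<phi> (fst y)) \<in> borel_measurable (count_space X \<Otimes>\<^sub>M S)"
    by (rule measurable_compose[OF measurable_fst]) simp
  then show ?thesis using assms by (auto simp: L_infty_def)
qed

lemma L_infty_cong:
  assumes "u \<in> L_infty M" "\<And>x. x \<in> space M \<Longrightarrow> u x = v x"
  shows "v \<in> L_infty M"
proof -
  have "v \<in> borel_measurable M" using assms by (auto simp: L_infty_def cong: measurable_cong)
  moreover obtain C where "AE x in M. \<bar>u x\<bar> \<le> C" using assms by (auto simp: L_infty_def)
  then have "AE x in M. \<bar>v x\<bar> \<le> C"
    using AE_space by eventually_elim (simp add: assms(2)[symmetric])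
  ultimately show ?thesis by (auto simp: L_infty_def)
qed

text \<open>An equivariant conditional expectation restricts to an equivariant positive unital map \<open>\<Phi>\<close> from
  the bounded functions on \<open>G\<close>, viewed as functions of the first coordinate on \<open>G \<times> S\<close>, to
  \<open>L_infty S\<close>. Nothing else of amenability is needed.\<close>

lemma zimmer_amenable_mean:
  fixes G :: "('g, 'm) monoid_scheme" and S :: "'s measure"
  assumes amenable: "zimmer_amenable G S act"
  obtains \<Phi> :: "('g \<Rightarrow> real) \<Rightarrow> 's \<Rightarrow> real"
  where "\<And>\<phi> C. (\<And>h. \<bar>\<phi> h\<bar> \<le> C) \<Longrightarrow> \<Phi> \<phi> \<in> L_infty S"
    and "\<And>\<phi> \<psi> C C' \<alpha> \<beta>. (\<And>h. \<bar>\<phi> h\<bar> \<le> C) \<Longrightarrow> (\<And>h. \<bar>\<psi> h\<bar> \<le> C') \<Longrightarrow>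
      AE x in S. \<Phi> (\<lambda>h. \<alpha> * \<phi> h + \<beta> * \<psi> h) x = \<alpha> * \<Phi> \<phi> x + \<beta> * \<Phi> \<psi> x"
    and "\<And>\<phi> C. (\<And>h. \<bar>\<phi> h\<bar> \<le> C) \<Longrightarrow> (\<And>h. h \<in> carrier G \<Longrightarrow> 0 \<le> \<phi> h) \<Longrightarrow> AE x in S. 0 \<le> \<Phi> \<phi> x"
    and "AE x in S. \<Phi> (\<lambda>h. 1) x = 1"
    and "\<And>\<phi> C g. (\<And>h. \<bar>\<phi> h\<bar> \<le> C) \<Longrightarrow> g \<in> carrier G \<Longrightarrow>
      AE x in S. \<Phi> (\<lambda>h. \<phi> (g \<otimes>\<^bsub>G\<^esub> h)) x = \<Phi> \<phi> (act g x)"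
proof -
  define Y where "Y = count_space (carrier G) \<Otimes>\<^sub>M S"
  define diag where "diag = diagonal_action (count_space (carrier G)) (left_translation G) S act"
  have "\<exists>E. equivariant_cond_exp G Y diag S act snd E"
    using amenable by (simp add: zimmer_amenable_def Y_def diag_def)
  then obtain E where E: "equivariant_cond_exp G Y diag S act snd E" ..
  have E_pos: "AE x in S. 0 \<le> E u x" if "u \<in> L_infty Y" "AE y in Y. 0 \<le> u y" for u
    using E that by (simp add: equivariant_cond_exp_def)
  have E_cong: "AE x in S. E u x = E v x"
    if "u \<in> L_infty Y" "v \<in> L_infty Y" "AE y in Y. u y = v y" for u v
    using E that by (simp add: equivariant_cond_exp_def)
  have E_act: "AE x in S. E (\<lambda>y. u (diag g y)) x = E u (act g x)"
    if "u \<in> L_infty Y" "g \<in> carrier G" for u g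
    using E that by (simp add: equivariant_cond_exp_def)
  have E_lin: "AE x in S. E (\<lambda>y. \<alpha> * u y + \<beta> * v y) x = \<alpha> * E u x + \<beta> * E v x"
    if "u \<in> L_infty Y" "v \<in> L_infty Y" for u v and \<alpha> \<beta> :: real
    using E that by (simp add: equivariant_cond_exp_def)
  define \<Phi> where "\<Phi> \<phi> = E (\<lambda>y. \<phi> (fst y))" for \<phi>
  note lift = lift_L_infty[where X = "carrier G" and S = S, folded Y_def]
  show thesis
  proof
    fix \<phi> :: "'g \<Rightarrow> real" and C assume \<phi>: "\<And>h. \<bar>\<phi> h\<bar> \<le> C"
    show "\<Phi> \<phi> \<in> L_infty S"
      using E lift[of \<phi> C, OF \<phi>] unfolding equivariant_cond_exp_def \<Phi>_def by blast
    show "AE x in S. 0 \<le> \<Phi> \<phi> x" if "\<And>h. h \<in> carrier G \<Longrightarrow> 0 \<le> \<phi> h"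
    proof -
      have "AE y in Y. 0 \<le> \<phi> (fst y)"
        using that by (intro AE_I2) (auto simp: Y_def space_pair_measure)
      then show ?thesis unfolding \<Phi>_def by (rule E_pos[OF lift[of \<phi> C, OF \<phi>]])
    qed
    show "AE x in S. \<Phi> (\<lambda>h. \<phi> (g \<otimes>\<^bsub>G\<^esub> h)) x = \<Phi> \<phi> (act g x)" if g: "g \<in> carrier G" for g
    proof -
      have eq: "\<phi> (g \<otimes>\<^bsub>G\<^esub> fst y) = \<phi> (fst (diag g y))" if "y \<in> space Y" for y
        using that by (auto simp: Y_def space_pair_measure diag_def diagonal_action_def left_translation_def)
      have L1: "(\<lambda>y. \<phi> (g \<otimes>\<^bsub>G\<^esub> fst y)) \<in> L_infty Y" by (rule lift) (rule \<phi>)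
      have L2: "(\<lambda>y. \<phi> (fst (diag g y))) \<in> L_infty Y" by (rule L_infty_cong[OF L1 eq])
      have "AE x in S. E (\<lambda>y. \<phi> (g \<otimes>\<^bsub>G\<^esub> fst y)) x = E (\<lambda>y. \<phi> (fst (diag g y))) x"
        by (rule E_cong[OF L1 L2 AE_I2]) (rule eq)
      moreover have "AE x in S. E (\<lambda>y. \<phi> (fst (diag g y))) x = E (\<lambda>y. \<phi> (fst y)) (act g x)"
        by (rule E_act[OF lift[of \<phi> C, OF \<phi>] g])
      ultimately show ?thesis unfolding \<Phi>_def by eventually_elim simp
    qed
  next
    fix \<phi> \<psi> :: "'g \<Rightarrow> real" and C C' \<alpha> \<beta> :: real
    assume \<phi>: "\<And>h. \<bar>\<phi> h\<bar> \<le> C" and \<psi>: "\<And>h. \<bar>\<psi> h\<bar> \<le> C'"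
    show "AE x in S. \<Phi> (\<lambda>h. \<alpha> * \<phi> h + \<beta> * \<psi> h) x = \<alpha> * \<Phi> \<phi> x + \<beta> * \<Phi> \<psi> x"
      unfolding \<Phi>_def by (rule E_lin[OF lift[of \<phi> C, OF \<phi>] lift[of \<psi> C', OF \<psi>]])
  next
    show "AE x in S. \<Phi> (\<lambda>h. 1) x = 1" using E by (simp add: equivariant_cond_exp_def \<Phi>_def)
  qed
qed

lemma affine_le_of_rational:
  fixes f :: "real \<Rightarrow> real"
  assumes cont: "continuous_on {0<..} f"
    and rat: "\<And>q :: rat. 0 < q \<Longrightarrow> u * of_rat q + v \<le> f (of_rat q)" and s: "0 < s"
  shows "u * s + v \<le> f s"
proof (rule ccontr)
  assume contr: "\<not> u * s + v \<le> f s"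
  define A where "A = {0<..} \<inter> (\<lambda>s. u * s + v - f s) -` {0<..}"
  have "open A"
    unfolding A_def by (intro continuous_open_preimage continuous_intros cont)
  moreover have "s \<in> A" using contr s by (simp add: A_def)
  ultimately obtain e where e: "0 < e" "ball s e \<subseteq> A" by (meson open_contains_ball)
  obtain q where q: "s < of_rat q" "of_rat q < s + e" using of_rat_dense[of s "s + e"] e(1) by auto
  then have "of_rat q \<in> A" using e(2) by (auto simp: dist_real_def)
  moreover have "0 < q" using q(1) s by (metis less_trans zero_less_of_rat_iff)
  ultimately show False using rat[of q] by (simp add: A_def)
qed

lemma ennreal_sum_le: "ennreal (\<Sum>i\<in>I. h i) \<le> (\<Sum>i\<in>I. ennreal (h i))"
proof -
  have "ennreal (\<Sum>i\<in>I. h i) \<le> ennreal (\<Sum>i\<in>I. max 0 (h i))"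
    by (intro ennreal_leI sum_mono) simp
  also have "\<dots> = (\<Sum>i\<in>I. ennreal (max 0 (h i)))" by (rule sum_ennreal[symmetric]) simp
  also have "\<dots> = (\<Sum>i\<in>I. ennreal (h i))" by (intro sum.cong refl) (simp add: max_def ennreal_neg)
  finally show ?thesis .
qed

context translation_entropy
begin

text \<open>The inequality that uses amenability. A field of lines below \<open>f\<close> on \<open>G\<close> is carried by \<open>\<Phi>\<close> to a field
  of lines below \<open>f\<close> on \<open>S\<close>, because \<open>\<Phi>\<close> is linear and positive. By equivariance, the sum of the
  integrals of the coefficients, weighted by \<open>lam\<close>, is the integral of the image of \<open>payoff x\<close>, which is at least \<open>c\<close>.\<close>

lemma entropy_sum_ge:
  fixes S :: "'s measure"
  assumes S: "g_space G S act" and amenable: "zimmer_amenable G S act" and \<nu>: "\<nu> \<in> class_probs S"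
    and x: "\<And>i. x i \<in> tangent_pairs B" and c: "\<And>k. k \<in> carrier G \<Longrightarrow> c \<le> payoff x k"
  shows "ennreal c \<le> entropy_sum act lam f \<nu>"
proof -
  interpret S: g_space G S act by fact
  interpret \<nu>: prob_space \<nu> by (rule class_probsD[OF \<nu>])
  obtain \<Phi> :: "('g \<Rightarrow> real) \<Rightarrow> 's \<Rightarrow> real"
    where \<Phi>_L: "\<And>\<phi> C. (\<And>h. \<bar>\<phi> h\<bar> \<le> C) \<Longrightarrow> \<Phi> \<phi> \<in> L_infty S"
    and \<Phi>_lin: "\<And>\<phi> \<psi> C C' \<alpha> \<beta>. (\<And>h. \<bar>\<phi> h\<bar> \<le> C) \<Longrightarrow> (\<And>h. \<bar>\<psi> h\<bar> \<le> C') \<Longrightarrow>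
      AE x in S. \<Phi> (\<lambda>h. \<alpha> * \<phi> h + \<beta> * \<psi> h) x = \<alpha> * \<Phi> \<phi> x + \<beta> * \<Phi> \<psi> x"
    and \<Phi>_pos: "\<And>\<phi> C. (\<And>h. \<bar>\<phi> h\<bar> \<le> C) \<Longrightarrow> (\<And>h. h \<in> carrier G \<Longrightarrow> 0 \<le> \<phi> h) \<Longrightarrow> AE x in S. 0 \<le> \<Phi> \<phi> x"
    and \<Phi>_one: "AE x in S. \<Phi> (\<lambda>h. 1) x = 1"
    and \<Phi>_act: "\<And>\<phi> C g. (\<And>h. \<bar>\<phi> h\<bar> \<le> C) \<Longrightarrow> g \<in> carrier G \<Longrightarrow>
      AE x in S. \<Phi> (\<lambda>h. \<phi> (g \<otimes> h)) x = \<Phi> \<phi> (act g x)"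
    using zimmer_amenable_mean[OF amenable] by blast
  note AE_\<nu> = class_probs_AE_iff[OF \<nu>]
  have \<Phi>_ge: "AE x in S. c \<le> \<Phi> \<phi> x"
    if \<phi>: "\<And>h. \<bar>\<phi> h\<bar> \<le> C" and "\<And>h. h \<in> carrier G \<Longrightarrow> c \<le> \<phi> h" for \<phi> C c
  proof -
    have "AE x in S. \<Phi> (\<lambda>h. 1 * \<phi> h + (-c) * 1) x = 1 * \<Phi> \<phi> x + (-c) * \<Phi> (\<lambda>h. 1) x"
      by (rule \<Phi>_lin[of \<phi> C "\<lambda>_. 1" 1, OF \<phi>]) simp
    moreover have "\<bar>1 * \<phi> h + (-c) * 1\<bar> \<le> C + \<bar>c\<bar>" for h using \<phi>[of h] by simp
    then have "AE x in S. 0 \<le> \<Phi> (\<lambda>h. 1 * \<phi> h + (-c) * 1) x"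
      by (rule \<Phi>_pos) (use that in auto)
    ultimately show ?thesis using \<Phi>_one by eventually_elim simp
  qed
  define L where "L \<phi> = (\<integral>s. \<Phi> \<phi> s \<partial>\<nu>)" for \<phi>
  have \<Phi>_L\<nu>: "\<Phi> \<phi> \<in> L_infty \<nu>" if "\<And>h. \<bar>\<phi> h\<bar> \<le> C" for \<phi> C
    using \<Phi>_L[OF that] by (simp add: class_probs_L_infty[OF \<nu>])
  have int: "integrable \<nu> (\<Phi> \<phi>)" if \<phi>: "\<And>h. \<bar>\<phi> h\<bar> \<le> C" for \<phi> C
  proof -
    obtain K where "AE s in \<nu>. \<bar>\<Phi> \<phi> s\<bar> \<le> K" "\<Phi> \<phi> \<in> borel_measurable \<nu>"
      using \<Phi>_L\<nu>[of \<phi> C, OF \<phi>] by (auto simp: L_infty_def)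
    then show ?thesis by (intro \<nu>.integrable_const_bound[where B = K]) auto
  qed
  have L_lin: "L (\<lambda>h. \<alpha> * \<phi> h + \<beta> * \<psi> h) = \<alpha> * L \<phi> + \<beta> * L \<psi>"
    if \<phi>: "\<And>h. \<bar>\<phi> h\<bar> \<le> C" and \<psi>: "\<And>h. \<bar>\<psi> h\<bar> \<le> C'" for \<phi> \<psi> C C' \<alpha> \<beta>
  proof -
    have "\<bar>\<alpha> * \<phi> h + \<beta> * \<psi> h\<bar> \<le> \<bar>\<alpha>\<bar> * C + \<bar>\<beta>\<bar> * C'" for h
      using \<phi>[of h] \<psi>[of h]
      by (intro order_trans[OF abs_triangle_ineq] add_mono) (auto simp: abs_mult intro!: mult_left_mono)
    from int[of "\<lambda>h. \<alpha> * \<phi> h + \<beta> * \<psi> h", OF this]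
    have i: "integrable \<nu> (\<Phi> (\<lambda>h. \<alpha> * \<phi> h + \<beta> * \<psi> h))" .
    have "L (\<lambda>h. \<alpha> * \<phi> h + \<beta> * \<psi> h) = (\<integral>s. \<alpha> * \<Phi> \<phi> s + \<beta> * \<Phi> \<psi> s \<partial>\<nu>)"
      unfolding L_def using \<Phi>_lin[of \<phi> C \<psi> C' \<alpha> \<beta>, OF \<phi> \<psi>] i int[of \<phi> C, OF \<phi>] int[of \<psi> C', OF \<psi>]
      by (intro integral_cong_AE) (auto simp: AE_\<nu>)
    then show ?thesis using int[of \<phi> C, OF \<phi>] int[of \<psi> C', OF \<psi>] by (simp add: L_def)
  qed
  have L_sum: "L (\<lambda>h. \<Sum>g\<in>F. w g * \<phi> g h) = (\<Sum>g\<in>F. w g * L (\<phi> g))"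
    if "finite F" and \<phi>: "\<And>g h. \<bar>\<phi> g h\<bar> \<le> C" for F and w :: "'g \<Rightarrow> real" and \<phi> C
    using \<open>finite F\<close>
  proof (induction F)
    case empty
    show ?case using L_lin[of "\<lambda>_. 0" 0 "\<lambda>_. 0" 0 0 0] by simp
  next
    case (insert g F)
    have "\<bar>\<Sum>g\<in>F. w g * \<phi> g h\<bar> \<le> (\<Sum>g\<in>F. \<bar>w g\<bar> * C)" for h
      by (rule order_trans[OF sum_abs]) (auto intro!: sum_mono mult_left_mono \<phi> simp: abs_mult)
    from L_lin[of "\<phi> g" C "\<lambda>h. \<Sum>g\<in>F. w g * \<phi> g h" _ "w g" 1, OF \<phi> this] insert show ?case by simp
  qed
  define u where "u g h = fst (x (g, h))" for g h
  define v where "v g h = snd (x (g, h))" for g h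
  have u: "\<bar>u g h\<bar> \<le> B" and v: "\<bar>v g h\<bar> \<le> B" and tan: "0 < s \<Longrightarrow> u g h * s + v g h \<le> f s" for g h s
    using x[of "(g, h)"] by (auto simp: u_def v_def tangent_pairs_def)
  have D: "ennreal (L (\<lambda>h. u g (g \<otimes> h) + v g h)) \<le> f_divergence f (distr \<nu> \<nu> (act g)) \<nu>"
    if "g \<in> set_pmf lam" for g
  proof -
    have g: "g \<in> carrier G" using that set_lam T_carrier by auto
    interpret X: equivalent_probs "distr \<nu> \<nu> (act g)" \<nu> by (rule S.equivalent_probs_act[OF \<nu> g])
    \<comment> \<open>The image lines lie below \<open>f\<close> almost everywhere at any given argument; the exceptional null sets
      are collected over the rational arguments only.\<close>
    have "AE s in S. \<forall>q :: rat. 0 < q \<longrightarrow> \<Phi> (u g) s * of_rat q + \<Phi> (v g) s \<le> f (of_rat q)"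
    proof (subst AE_all_countable, intro allI)
      fix q :: rat
      show "AE s in S. 0 < q \<longrightarrow> \<Phi> (u g) s * of_rat q + \<Phi> (v g) s \<le> f (of_rat q)"
      proof (cases "0 < q")
        case True
        have "AE s in S. \<Phi> (\<lambda>h. - of_rat q * u g h + (-1) * v g h) s = - of_rat q * \<Phi> (u g) s + (-1) * \<Phi> (v g) s"
          by (rule \<Phi>_lin[of "u g" B "v g" B, OF u v])
        moreover have "AE s in S. - f (of_rat q) \<le> \<Phi> (\<lambda>h. - of_rat q * u g h + (-1) * v g h) s"
        proof (rule \<Phi>_ge)
          show "\<bar>- of_rat q * u g h + (-1) * v g h\<bar> \<le> of_rat q * B + B" for h
          proof -
            have "\<bar>- of_rat q * u g h + (-1) * v g h\<bar> \<le> \<bar>of_rat q * u g h\<bar> + \<bar>v g h\<bar>"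
              by simp
            also have "\<bar>of_rat q * u g h\<bar> \<le> of_rat q * B"
              using True u[of g h] by (simp add: abs_mult)
            finally show ?thesis using v[of g h] by linarith
          qed
          show "- f (of_rat q) \<le> - of_rat q * u g h + (-1) * v g h" for h
            using tan[of "of_rat q" g h] True by (simp add: mult.commute)
        qed
        ultimately show ?thesis by eventually_elim (simp add: mult.commute)
      qed simp
    qed
    then have "AE s in \<nu>. \<forall>q :: rat. 0 < q \<longrightarrow> \<Phi> (u g) s * of_rat q + \<Phi> (v g) s \<le> f (of_rat q)"
      by (simp add: AE_\<nu>)
    then have le: "AE s in \<nu>. \<Phi> (u g) s * X.r s + \<Phi> (v g) s \<le> f (X.r s)"
      using X.r_pos by eventually_elim (rule affine_le_of_rational[OF cont], auto)
    have bdd: "\<bar>u g (g \<otimes> h)\<bar> \<le> B" for h by (rule u)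
    have act_\<nu>: "act g \<in> measurable \<nu> \<nu>"
      using S.measurable_act[OF g] measurable_cong_sets[OF class_probsD(2)[OF \<nu>] class_probsD(2)[OF \<nu>]] by simp
    have meas: "\<Phi> (u g) \<in> borel_measurable \<nu>" using \<Phi>_L\<nu>[of "u g" B, OF u] by (simp add: L_infty_def)
    have "(\<integral>s. \<Phi> (u g) s \<partial>distr \<nu> \<nu> (act g)) = (\<integral>s. \<Phi> (u g) (act g s) \<partial>\<nu>)"
      by (rule integral_distr[OF act_\<nu> meas])
    also have "\<dots> = L (\<lambda>h. u g (g \<otimes> h))"
      unfolding L_def using \<Phi>_act[of "u g" B g, OF u g] int[of "\<lambda>h. u g (g \<otimes> h)" B, OF bdd] measurable_compose[OF act_\<nu> meas]
      by (intro integral_cong_AE) (auto simp: AE_\<nu>)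
    finally have "(\<integral>s. \<Phi> (u g) s \<partial>distr \<nu> \<nu> (act g)) + (\<integral>s. \<Phi> (v g) s \<partial>\<nu>) = L (\<lambda>h. u g (g \<otimes> h) + v g h)"
      using L_lin[of "\<lambda>h. u g (g \<otimes> h)" B "v g" B 1 1, OF bdd v] by (simp add: L_def)
    with X.f_divergence_ge[OF \<Phi>_L\<nu>[of "u g" B, OF u] \<Phi>_L\<nu>[of "v g" B, OF v] le] show ?thesis by simp
  qed
  have "AE s in \<nu>. c \<le> \<Phi> (payoff x) s"
    using \<Phi>_ge[of "payoff x" "2 * B" c, OF abs_payoff_le[OF x] c] by (simp add: AE_\<nu>)
  then have "(\<integral>s. c \<partial>\<nu>) \<le> L (payoff x)"
    unfolding L_def by (intro integral_mono_AE int[of "payoff x" "2 * B", OF abs_payoff_le[OF x]]) auto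
  then have "c \<le> L (payoff x)" using \<nu>.prob_space by simp
  also have "payoff x = (\<lambda>h. \<Sum>g\<in>set_pmf lam. pmf lam g * (u g (g \<otimes> h) + v g h))"
    by (simp add: fun_eq_iff payoff_def u_def v_def)
  also have "L \<dots> = (\<Sum>g\<in>set_pmf lam. pmf lam g * L (\<lambda>h. u g (g \<otimes> h) + v g h))"
  proof (rule L_sum[OF finite_lam])
    show "\<bar>u g (g \<otimes> h) + v g h\<bar> \<le> B + B" for g h
      using u[of g "g \<otimes> h"] v[of g h] by linarith
  qed
  finally have "ennreal c \<le> ennreal (\<Sum>g\<in>set_pmf lam. pmf lam g * L (\<lambda>h. u g (g \<otimes> h) + v g h))"
    by (rule ennreal_leI)
  also have "\<dots> \<le> (\<Sum>g\<in>set_pmf lam. ennreal (pmf lam g * L (\<lambda>h. u g (g \<otimes> h) + v g h)))"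
    by (rule ennreal_sum_le)
  also have "\<dots> \<le> entropy_sum act lam f \<nu>"
    unfolding entropy_sum_def by (intro sum_mono) (simp add: ennreal_mult' mult_left_mono D)
  finally show ?thesis .
qed

end

section \<open>Equality of the minimal entropies\<close>

lemma enn2ereal_entropy_sum:
  "enn2ereal (entropy_sum act lam f \<nu>) =
    (\<Sum>g\<in>set_pmf lam. ereal (pmf lam g) * enn2ereal (f_divergence f (distr \<nu> \<nu> (act g)) \<nu>))"
proof -
  have "enn2ereal (\<Sum>g\<in>F. ennreal (pmf lam g) * h g) = (\<Sum>g\<in>F. ereal (pmf lam g) * enn2ereal (h g))"
    if "finite F" for F and h :: "'a \<Rightarrow> ennreal"
    using that by induction (simp_all add: plus_ennreal.rep_eq times_ennreal.rep_eq zero_ennreal.rep_eq)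
  then show ?thesis
    unfolding entropy_sum_def by (cases "finite (set_pmf lam)") (simp_all add: zero_ennreal.rep_eq)
qed

lemma furstenberg_entropy_eq:
  assumes lam: "set_pmf lam \<subseteq> carrier G" "finite (set_pmf lam)"
    and gen: "entropy_generator (\<lambda>t. f t - c * (t - 1)) a"
    and equiv: "\<And>g. g \<in> carrier G \<Longrightarrow> equivalent_probs (distr \<nu> \<nu> (act g)) \<nu>"
  shows "furstenberg_entropy G act lam f \<nu> = enn2ereal (entropy_sum act lam (\<lambda>t. f t - c * (t - 1)) \<nu>)"
proof -
  have "furstenberg_entropy G act lam f \<nu> =
      (\<Sum>\<^sub>\<infinity>g\<in>set_pmf lam. ereal (pmf lam g) *
        ext_integral \<nu> (\<lambda>x. f (enn2real (RN_deriv \<nu> (distr \<nu> \<nu> (act g)) x))))"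
    unfolding furstenberg_entropy_def
    by (rule infsum_cong_neutral) (use lam in \<open>auto simp: set_pmf_eq zero_ereal_def[symmetric]\<close>)
  also have "\<dots> = (\<Sum>g\<in>set_pmf lam. ereal (pmf lam g) *
      enn2ereal (f_divergence (\<lambda>t. f t - c * (t - 1)) (distr \<nu> \<nu> (act g)) \<nu>))"
    unfolding infsum_finite[OF lam(2)]
    using lam(1) equivalent_probs.ext_integral_eq_f_divergence[OF equiv gen]
    by (intro sum.cong refl) (simp add: subset_iff)
  finally show ?thesis by (simp add: enn2ereal_entropy_sum)
qed

theorem theorem1:
  fixes G :: "('g, 'm) monoid_scheme"
    and S :: "'s measure"
    and act :: "'g \<Rightarrow> 's \<Rightarrow> 's"
    and lam :: "'g pmf"
    and f :: "real \<Rightarrow> real"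
  assumes "group G" and "countable (carrier G)"
    and "g_space G S act"
    and "zimmer_amenable G S act"
    and "set_pmf lam \<subseteq> carrier G" and "finite (set_pmf lam)"
    and "generate G (set_pmf lam) = carrier G"
    and "convex_on {0<..} f" and "f 1 = 0"
  shows "minimal_entropy G S act lam f =
         minimal_entropy G (count_space (carrier G)) (left_translation G) lam f"
proof -
  interpret group G by fact
  interpret S: g_space G S act by fact
  obtain a where a: "\<And>s t. 0 < s \<Longrightarrow> 0 < t \<Longrightarrow> f t + a t * (s - t) \<le> f s"
    using convex_on_Ioi_subgradient[OF assms(8)] by blast
  \<comment> \<open>Subtracting the supporting line at \<open>1\<close> makes the function nonnegative.\<close>
  define c where "c = a 1"
  define \<phi> where "\<phi> = (\<lambda>t. f t - c * (t - 1))"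
  have gen: "entropy_generator \<phi> (\<lambda>t. a t - c)"
  proof
    show "\<phi> t + (a t - c) * (s - t) \<le> \<phi> s" if "0 < s" "0 < t" for s t
      using a[OF that] by (simp add: \<phi>_def algebra_simps)
    show "0 \<le> \<phi> t" if "0 < t" for t
      using a[OF that, of 1] assms(9) by (simp add: \<phi>_def c_def)
    show "\<phi> 1 = 0" by (simp add: \<phi>_def assms(9))
    have "continuous_on {0<..} f" by (rule convex_on_continuous[OF _ assms(8)]) simp
    then show "continuous_on {0<..} \<phi>" unfolding \<phi>_def by (intro continuous_intros)
  qed
  \<comment> \<open>\<open>lam\<close> need not be symmetric, but the two-sided bounds on derivatives need inverses.\<close>
  define T where "T = set_pmf lam \<union> (\<lambda>g. inv\<^bsub>G\<^esub> g) ` set_pmf lam"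
  have T: "finite T" "T \<noteq> {}" "T \<subseteq> carrier G" "set_pmf lam \<subseteq> T"
    using assms(5,6) set_pmf_not_empty[of lam] by (auto simp: T_def)
  have T_inv: "inv\<^bsub>G\<^esub> g \<in> T" if "g \<in> T" for g
    using that assms(5) by (auto simp: T_def)
  have gen_T: "generate G T = carrier G"
    using generate_incl[OF T(3)] mono_generate[OF T(4)] assms(7) by blast
  interpret translation_entropy G \<phi> "\<lambda>t. a t - c" lam T
    by (intro translation_entropy.intro translation_entropy_axioms.intro gen T T_inv is_group)
  have h_S: "furstenberg_entropy G act lam f \<nu> = enn2ereal (entropy_sum act lam \<phi> \<nu>)"
    if "\<nu> \<in> class_probs S" for \<nu>
    unfolding \<phi>_def
    by (rule furstenberg_entropy_eq[OF assms(5,6) gen[unfolded \<phi>_def] S.equivalent_probs_act[OF that]])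
  have h_G: "furstenberg_entropy G (left_translation G) lam f \<mu> =
      enn2ereal (entropy_sum (left_translation G) lam \<phi> \<mu>)"
    if "\<mu> \<in> class_probs (count_space (carrier G))" for \<mu>
    unfolding \<phi>_def
    by (rule furstenberg_entropy_eq[OF assms(5,6) gen[unfolded \<phi>_def] equivalent_probs_left_translation[OF that]])
  let ?I_S = "minimal_entropy G S act lam f"
  let ?I_G = "minimal_entropy G (count_space (carrier G)) (left_translation G) lam f"
  show ?thesis
  proof (rule antisym)
    show "?I_S \<le> ?I_G"
      unfolding minimal_entropy_def
    proof (rule INF_greatest)
      fix \<mu> assume \<mu>: "\<mu> \<in> class_probs (count_space (carrier G))"
      obtain \<eta> where "\<eta> \<in> class_probs S"
        "entropy_sum act lam \<phi> \<eta> \<le> entropy_sum (left_translation G) lam \<phi> \<mu>"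
        using S.convolution_entropy_le[OF \<mu> gen assms(5)] by blast
      then show "(INF \<nu>\<in>class_probs S. furstenberg_entropy G act lam f \<nu>)
          \<le> furstenberg_entropy G (left_translation G) lam f \<mu>"
        by (intro INF_lower2[of \<eta>]) (simp_all add: h_S h_G[OF \<mu>] less_eq_ennreal.rep_eq)
    qed
  next
    obtain \<kappa> N where "bounded_ratio T N \<kappa>"
      using exists_bounded_ratio[OF T(1-3) T_inv gen_T] by blast
    moreover obtain m where "N \<le> real m" using real_arch_simple by blast
    ultimately have \<kappa>: "bounded_ratio T (real (Suc m)) \<kappa>"
      by (auto intro: bounded_ratio_mono)
    have I_G_le: "?I_G \<le> enn2ereal (entropy_sum (left_translation G) lam \<phi> (mass p))"
      if "set_pmf p = carrier G" for p
      unfolding minimal_entropy_def h_G[OF mass_in_class_probs[OF that], symmetric]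
      by (rule INF_lower[OF mass_in_class_probs[OF that]])
    have "0 \<le> ?I_G"
      unfolding minimal_entropy_def by (rule INF_greatest) (simp add: h_G)
    moreover have "?I_G < \<infinity>"
      using I_G_le[of \<kappa>] \<kappa> expectation_payoff_touch[OF \<kappa>] 
      by (auto simp: bounded_ratio_def enn2ereal_ennreal intro: le_less_trans dest!: sym[of "ennreal _"])
    ultimately obtain I where I: "?I_G = ereal I" "0 \<le> I" by (cases ?I_G) auto
    define H where "H = slope_bound m * (real (Suc m) + 1)"
    have "0 \<le> H" unfolding H_def by (intro mult_nonneg_nonneg slope_bound_nonneg) simp
    have I_le: "ennreal I \<le> entropy_sum (left_translation G) lam \<phi> (mass p)" if "set_pmf p = carrier G" for p
      using I_G_le[OF that] I by (simp add: less_eq_ennreal.rep_eq enn2ereal_ennreal)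
    show "?I_G \<le> ?I_S"
      unfolding I(1)
    proof (subst minimal_entropy_def, rule INF_greatest)
      fix \<nu> assume \<nu>: "\<nu> \<in> class_probs S"
      have ge: "ennreal ((I - t * H) / (1 - t)) \<le> entropy_sum act lam \<phi> \<nu>" if t: "0 < t" "t < 1" for t
      proof -
        obtain x B where x: "\<And>i. x i \<in> tangent_pairs B"
          and "\<And>k. k \<in> carrier G \<Longrightarrow> I \<le> t * H + (1 - t) * payoff x k"
          using exists_dual_optimum[OF I_le \<kappa> t] unfolding H_def by blast
        then have "(I - t * H) / (1 - t) \<le> payoff x k" if "k \<in> carrier G" for k
          using t that by (simp add: pos_divide_le_eq mult.commute algebra_simps)
        then show ?thesis by (rule entropy_sum_ge[OF assms(3,4) \<nu> x])
      qed
      show "ereal I \<le> furstenberg_entropy G act lam f \<nu>"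
      proof (cases "entropy_sum act lam \<phi> \<nu>")
        case (real h)
        have "I \<le> h + \<epsilon>" if "0 < \<epsilon>" for \<epsilon>
        proof -
          define t where "t = min (1/2) (\<epsilon> / (H + 1))"
          have t: "0 < t" "t < 1" using that \<open>0 \<le> H\<close> by (auto simp: t_def)
          have "(I - t * H) / (1 - t) \<le> h" using ge[OF t] real by (simp add: ennreal_le_iff)
          then have "I \<le> h * (1 - t) + t * H" using t by (simp add: pos_divide_le_eq)
          also have "h * (1 - t) \<le> h * 1" using t real by (intro mult_left_mono) auto
          also have "t * H \<le> \<epsilon> / (H + 1) * H"
            using \<open>0 \<le> H\<close> by (intro mult_right_mono) (simp_all add: t_def)
          also have "\<dots> \<le> \<epsilon>" using \<open>0 \<le> H\<close> that by (simp add: field_simps)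
          finally show ?thesis by simp
        qed
        then have "I \<le> h" by (rule field_le_epsilon)
        then show ?thesis using real by (simp add: h_S[OF \<nu>] enn2ereal_ennreal)
      qed (simp add: h_S[OF \<nu>])
    qed
  qed
qed

end
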